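(* Let $k>g\ge 2$ and $1\le i\le g$ be integers. Let $a_{2i-1},a_{2i},a_{2i+1}\in\mathbb{R}$ be such that $$\sum_{j=2i-1}^{2i+1}a_jX^j=a_{2i+1}X^{2i-1}(X-x_{i,1})(X-x_{i,2})$$ with $a_{2i+1}\neq 0$ and $x_{i,1},x_{i,2}\in\mathbb{C}^*$ distinct. Let $C_{v_i}$ be the normalization of the compactification in $\mathbb{CP}^1\times\mathbb{CP}^1$ of the curve $Y^2=\sum_{j=2i-1}^{2i+1}a_jX^j$, and let $H_i$ be the real vector space generated by the rational functions $$X^j\ (0\le j\le k),\qquad X^{j}Y\ (0\le j\le k-g-1)$$ on $C_{v_i}$. Then $$H_i\subset H^0\bigl(C_{v_i},\mathcal{L}_{\mathbb{R}}(2k\cdot\infty)\bigr),$$ where $\infty$ denotes the support of the pullback of $\infty\in\mathbb{P}^1$ under the structure morphism $C_{v_i}\to\mathbb{P}^1$, $(X,Y)\mapsto X$.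
   Context: $C_{v_i}$ carries the real structure induced by $(X,Y)\mapsto(\overline{X},\overline{Y})$. It is a real curve of genus $1$, and the preimage of $\infty\in\mathbb{P}^1$ under the degree-two morphism $(X,Y)\mapsto X$ is a single point, denoted $\infty$. For a conjugation-invariant divisor $E$, $\mathcal{L}_{\mathbb{R}}(E)$ is the associated real line bundle, whose real global sections are identified with the real rational functions $h$ with $h=0$ or $\mathrm{div}(h)+E\ge 0$. *)

theory Defs
  imports
    "HOL-Analysis.Urysohn"
    "HOL-Algebra.Algebra"
    "HOL-Algebra.Algebraic_Closure_Type"
begin

section \<open>The function field\<close>

text \<open>
  Everything below depends on a polynomial \<open>f\<close> over the complex numbers, and refers to the curve
  \<open>Y\<^sup>2 = f(X)\<close>. It is meant for \<open>f\<close> that is not a square, so that the curve is irreducible.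
  Its field of rational functions is \<open>\<complex>(X)[Y] / (Y\<^sup>2 - f(X))\<close>; the elements are cosets.
\<close>

type_synonym ratfun = "complex poly fract poly set"

definition bivariate_ring :: "complex poly fract poly ring" where
  "bivariate_ring = ring_of_type_algebra"

definition curve_ideal :: "complex poly \<Rightarrow> complex poly fract poly set" where
  "curve_ideal f = PIdl\<^bsub>bivariate_ring\<^esub> [:- to_fract f, 0, 1:]"

definition function_field :: "complex poly \<Rightarrow> ratfun ring" where
  "function_field f = bivariate_ring Quot curve_ideal f"

definition residue_class :: "complex poly \<Rightarrow> complex poly fract poly \<Rightarrow> ratfun" where
  "residue_class f q = curve_ideal f +>\<^bsub>bivariate_ring\<^esub> q"

definition ratfun_const :: "complex poly \<Rightarrow> complex \<Rightarrow> ratfun" where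
  "ratfun_const f c = residue_class f [:to_fract [:c:]:]"

definition ratfun_X :: "complex poly \<Rightarrow> ratfun" where
  "ratfun_X f = residue_class f [:to_fract [:0, 1:]:]"

definition ratfun_Y :: "complex poly \<Rightarrow> ratfun" where
  "ratfun_Y f = residue_class f [:0, 1:]"


section \<open>The compactification in the product of two projective lines\<close>

text \<open>\<open>None\<close> is the point at infinity of the projective line.\<close>

definition proj_line :: "complex option topology" where
  "proj_line = Alexandroff_compactification (euclidean :: complex topology)"

definition affine_curve :: "complex poly \<Rightarrow> (complex \<times> complex) set" where
  "affine_curve f = {(x, y). y\<^sup>2 = poly f x}"

text \<open>For an algebraic curve the closure in the classical topology is the Zariski closure.\<close>

definition compactified_curve :: "complex poly \<Rightarrow> (complex option \<times> complex option) set" where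
  "compactified_curve f =
     prod_topology proj_line proj_line closure_of ((\<lambda>(x, y). (Some x, Some y)) ` affine_curve f)"

text \<open>
  The coordinate on a factor that vanishes at a given point: \<open>z - c\<close> at a finite point \<open>c\<close>,
  and \<open>1/z\<close> at infinity.
\<close>

fun local_coord :: "complex poly \<Rightarrow> ratfun \<Rightarrow> complex option \<Rightarrow> ratfun" where
  "local_coord f z (Some c) = z \<ominus>\<^bsub>function_field f\<^esub> ratfun_const f c"
| "local_coord f z None = inv\<^bsub>function_field f\<^esub> z"

text \<open>
  Coordinate ring of the part of the compactified curve in the standard affine chart
  around \<open>p\<close> (a subring of the function field), and the maximal ideal of \<open>p\<close> in it.
\<close>

definition chart_coords :: "complex poly \<Rightarrow> complex option \<times> complex option \<Rightarrow> ratfun set" where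
  "chart_coords f p = {local_coord f (ratfun_X f) (fst p), local_coord f (ratfun_Y f) (snd p)}"

definition chart_ring :: "complex poly \<Rightarrow> complex option \<times> complex option \<Rightarrow> ratfun set" where
  "chart_ring f p = generate_ring (function_field f) (range (ratfun_const f) \<union> chart_coords f p)"

definition chart_ideal :: "complex poly \<Rightarrow> complex option \<times> complex option \<Rightarrow> ratfun set" where
  "chart_ideal f p = Idl\<^bsub>function_field f\<lparr>carrier := chart_ring f p\<rparr>\<^esub> (chart_coords f p)"

text \<open>Localization, inside a field \<open>K\<close>, of a subring \<open>A\<close> at a prime ideal \<open>m\<close>.\<close>

definition localization_at :: "('a, 'b) ring_scheme \<Rightarrow> 'a set \<Rightarrow> 'a set \<Rightarrow> 'a set" where
  "localization_at K A m = {a \<otimes>\<^bsub>K\<^esub> inv\<^bsub>K\<^esub> b | a b. a \<in> A \<and> b \<in> A - m}"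

definition local_ring :: "complex poly \<Rightarrow> complex option \<times> complex option \<Rightarrow> ratfun set" where
  "local_ring f p = localization_at (function_field f) (chart_ring f p) (chart_ideal f p)"


section \<open>The normalization\<close>

definition integral_closure_in :: "('a, 'b) ring_scheme \<Rightarrow> 'a set \<Rightarrow> 'a set" where
  "integral_closure_in K A =
     {h \<in> carrier K. \<exists>(n::nat) c. c \<in> {..<n} \<rightarrow> A \<and>
        h [^]\<^bsub>K\<^esub> n \<oplus>\<^bsub>K\<^esub> (\<Oplus>\<^bsub>K\<^esub>j\<in>{..<n}. c j \<otimes>\<^bsub>K\<^esub> h [^]\<^bsub>K\<^esub> j) = \<zero>\<^bsub>K\<^esub>}"

definition normalized_local_ring :: "complex poly \<Rightarrow> complex option \<times> complex option \<Rightarrow> ratfun set" where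
  "normalized_local_ring f p = integral_closure_in (function_field f) (local_ring f p)"

text \<open>
  The points of the normalization lying over a point \<open>p\<close> of the compactified curve are the maximal
  ideals of the integral closure of the local ring at \<open>p\<close> in the function field; such a point is
  recorded together with its image \<open>p\<close>.
\<close>

type_synonym curve_point = "(complex option \<times> complex option) \<times> ratfun set"

definition normalized_curve :: "complex poly \<Rightarrow> curve_point set" where
  "normalized_curve f =
     {(p, m). p \<in> compactified_curve f \<and>
        maximalideal m (function_field f\<lparr>carrier := normalized_local_ring f p\<rparr>)}"

text \<open>The structure morphism to the projective line, \<open>(X, Y) \<mapsto> X\<close>.\<close>

definition structure_morphism :: "curve_point \<Rightarrow> complex option" where
  "structure_morphism P = fst (fst P)"

definition point_ring :: "complex poly \<Rightarrow> curve_point \<Rightarrow> ratfun ring" where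
  "point_ring f P = function_field f
     \<lparr>carrier := localization_at (function_field f) (normalized_local_ring f (fst P)) (snd P)\<rparr>"


section \<open>Divisors and real sections\<close>

text \<open>The local ring at a point of the normalization is a discrete valuation ring.\<close>

definition uniformizer :: "complex poly \<Rightarrow> curve_point \<Rightarrow> ratfun \<Rightarrow> bool" where
  "uniformizer f P t \<longleftrightarrow>
     t \<in> carrier (point_ring f P) \<and> maximalideal (PIdl\<^bsub>point_ring f P\<^esub> t) (point_ring f P)"

definition vanishing_order :: "complex poly \<Rightarrow> curve_point \<Rightarrow> ratfun \<Rightarrow> int" where
  "vanishing_order f P h =
     (THE n. \<exists>t u. uniformizer f P t \<and> u \<in> Units (point_ring f P) \<and>
                h = u \<otimes>\<^bsub>function_field f\<^esub> (t [^]\<^bsub>function_field f\<^esub> n))"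

text \<open>Divisors are integer-valued functions, of which only the values on the curve matter.\<close>

type_synonym curve_divisor = "curve_point \<Rightarrow> int"

definition principal_divisor :: "complex poly \<Rightarrow> ratfun \<Rightarrow> curve_divisor" where
  "principal_divisor f h = (\<lambda>P. vanishing_order f P h)"

definition effective :: "complex poly \<Rightarrow> curve_divisor \<Rightarrow> bool" where
  "effective f D \<longleftrightarrow> (\<forall>P\<in>normalized_curve f. D P \<ge> 0)"

text \<open>The reduced divisor of the points over infinity.\<close>

definition infinity_divisor :: "complex poly \<Rightarrow> curve_divisor" where
  "infinity_divisor f =
     (\<lambda>P. if P \<in> normalized_curve f \<and> structure_morphism P = None then 1 else 0)"

lemma map_poly_cnj_mult: "map_poly cnj (p * q) = map_poly cnj p * map_poly cnj q"
  by (rule poly_eqI) (simp add: coeff_map_poly coeff_mult)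

lemma map_poly_cnj_eq_0_iff: "map_poly cnj p = 0 \<longleftrightarrow> p = 0"
  by (simp add: poly_eq_iff coeff_map_poly)

text \<open>Independent of the chosen numerator and denominator, by \<open>fract_cnj_divide\<close>.\<close>

definition fract_cnj :: "complex poly fract \<Rightarrow> complex poly fract" where
  "fract_cnj r = (case quot_of_fract r of (p, q) \<Rightarrow>
     to_fract (map_poly cnj p) / to_fract (map_poly cnj q))"

lemma fract_cnj_divide:
  assumes "q \<noteq> 0"
  shows "fract_cnj (to_fract p / to_fract q) = to_fract (map_poly cnj p) / to_fract (map_poly cnj q)"
proof -
  obtain p' q' where pq: "quot_of_fract (to_fract p / to_fract q) = (p', q')"
    by fastforce
  have q': "q' \<noteq> 0"
    using snd_quot_of_fract_nonzero[of "to_fract p / to_fract q"] by (simp add: pq)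
  have "to_fract p / to_fract q = Fraction_Field.Fract p' q'"
    using Fract_quot_of_fract[of "to_fract p / to_fract q"] unfolding pq by simp
  hence "to_fract p / to_fract q = to_fract p' / to_fract q'"
    by (simp add: to_fract_def)
  hence "to_fract (p * q') = to_fract (p' * q)"
    using assms q' by (simp add: field_simps)
  hence "p * q' = p' * q"
    by (simp only: to_fract_eq_iff)
  hence "map_poly cnj p * map_poly cnj q' = map_poly cnj p' * map_poly cnj q"
    by (simp flip: map_poly_cnj_mult)
  hence "to_fract (map_poly cnj p) * to_fract (map_poly cnj q') =
         to_fract (map_poly cnj p') * to_fract (map_poly cnj q)"
    by (simp flip: to_fract_mult)
  thus ?thesis
    using assms q' by (simp add: fract_cnj_def pq map_poly_cnj_eq_0_iff field_simps)
qed

text \<open>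
  The involution \<open>h \<mapsto> cnj \<circ> h \<circ> ((X, Y) \<mapsto> (cnj X, cnj Y))\<close>, which conjugates all coefficients.
  For real \<open>f\<close> it maps cosets to cosets.
\<close>

definition ratfun_cnj :: "ratfun \<Rightarrow> ratfun" where
  "ratfun_cnj h = map_poly fract_cnj ` h"

definition real_ratfuns :: "complex poly \<Rightarrow> ratfun set" where
  "real_ratfuns f = {h \<in> carrier (function_field f). ratfun_cnj h = h}"

text \<open>Real global sections of the line bundle of a conjugation-invariant divisor \<open>E\<close>.\<close>

definition real_sections :: "complex poly \<Rightarrow> curve_divisor \<Rightarrow> ratfun set" where
  "real_sections f E =
     {h \<in> real_ratfuns f. h = \<zero>\<^bsub>function_field f\<^esub> \<or>
        effective f (\<lambda>P. principal_divisor f h P + E P)}"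

definition real_span :: "complex poly \<Rightarrow> ratfun list \<Rightarrow> ratfun set" where
  "real_span f hs = ring.Span (function_field f) (ratfun_const f ` \<real>) hs"

definition H_space :: "complex poly \<Rightarrow> nat \<Rightarrow> nat \<Rightarrow> ratfun set" where
  "H_space f k g = real_span f
     (map (\<lambda>j. ratfun_X f [^]\<^bsub>function_field f\<^esub> j) [0..<Suc k] @
      map (\<lambda>j. ratfun_X f [^]\<^bsub>function_field f\<^esub> j \<otimes>\<^bsub>function_field f\<^esub> ratfun_Y f)
        [0..<Suc (k - g - 1)])"

end

theory Submission
  imports Defs
begin

text \<open>
  Write \<open>K = \<complex>(X)[Y] / (Y\<^sup>2 - f)\<close>, with \<open>deg f = 2 i + 1\<close>. The double cover \<open>(X, Y) \<mapsto> X\<close> is branched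
  at infinity because \<open>deg f\<close> is odd, so \<open>1/X\<close> vanishes to order \<open>2\<close> and \<open>Y\<close>, whose square is \<open>f(X)\<close>,
  has a pole of order \<open>2 i + 1\<close> there. Hence \<open>X\<^sup>j\<close> has a pole of order \<open>2 j \<le> 2 k\<close> at infinity, and
  \<open>X\<^sup>j Y\<close> one of order \<open>2 j + 2 i + 1\<close>, which is at most \<open>2 k\<close> for \<open>j \<le> k - g - 1\<close> and \<open>i \<le> g\<close>. Elsewhere
  \<open>X\<close> and \<open>Y\<close> are regular, and the generating functions have real coefficients.

  To turn this into a statement about the normalization, one computes, for every point \<open>p\<close> of the plane
  compactification, the integral closure of its local ring in \<open>K\<close>, and sees that it is a discrete
  valuation ring. There is thus one point of the normalization over \<open>p\<close>, and orders of vanishing are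
  exponents of a uniformizer (\<open>vanishing_order_ge\<close>). Let \<open>z\<close> be \<open>X - c\<close> or \<open>1/X\<close>, and write \<open>\<O>\<close> for the
  functions in \<open>\<complex>(X)\<close> that are regular at \<open>z = 0\<close>.

  \<^item> If \<open>p = (c, d)\<close> with \<open>d \<noteq> 0\<close>, the curve is smooth at \<open>p\<close> with local parameter \<open>z\<close>
    (\<open>unramified_valuation_ring\<close>).

  \<^item> If \<open>p = (c, 0)\<close> or \<open>p = (\<infinity>, \<infinity>)\<close>, then \<open>f\<close> has odd order \<open>2 e + 1\<close> in \<open>z\<close>: the zero \<open>0\<close> of \<open>f\<close> has
    order \<open>2 i - 1\<close>, the zeros \<open>x\<^sub>1 \<noteq> x\<^sub>2\<close> are simple, and the order at infinity is \<open>- (2 i + 1)\<close>. So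
    \<open>W = Y / z\<^sup>e\<close> satisfies \<open>W\<^sup>2 = \<epsilon> z\<close> with a unit \<open>\<epsilon>\<close> of \<open>\<O>\<close>, and \<open>\<O> + \<O> W\<close> is a discrete valuation ring
    with uniformizer \<open>W\<close> (\<open>ramified_valuation_ring\<close>). It contains the local ring of \<open>p\<close>, and it is integral
    over it, since traces and norms of its elements lie in \<open>\<O>\<close> (\<open>ramified_ring_integral\<close>). As a discrete
    valuation ring is integrally closed, it is the integral closure.

  The pairs \<open>(c, \<infinity>)\<close> and \<open>(\<infinity>, d)\<close> carry no point of the normalization, because \<open>1/Y\<close> and \<open>Y - d\<close>,
  respectively, cannot vanish there, by the equation \<open>Y\<^sup>2 = f(X)\<close>.
\<close>

section \<open>Discrete valuation rings inside a field\<close>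

lemma (in field) int_pow_units_of:
  assumes "x \<in> carrier R - {\<zero>}"
  shows "x [^]\<^bsub>units_of R\<^esub> (n::int) = x [^] n"
proof -
  have "x [^] k \<in> Units R" for k :: nat
    using assms field_Units Units_pow_closed by auto
  then show ?thesis
    using assms field_Units by (simp add: int_pow_def2 units_of_pow units_of_inv del: pow_nat)
qed

lemma (in field) int_pow_nonzero:
  assumes "x \<in> carrier R - {\<zero>}"
  shows "x [^] (n::int) \<in> carrier R - {\<zero>}"
  using group.int_pow_closed[OF units_group, of x n] assms
  by (simp add: int_pow_units_of units_of_carrier field_Units)

lemma (in field) int_pow_add:
  assumes "x \<in> carrier R - {\<zero>}"
  shows "x [^] (m + n :: int) = x [^] m \<otimes> x [^] n"
  using group.int_pow_mult[OF units_group, of x m n] assms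
  by (simp add: int_pow_units_of units_of_carrier units_of_mult field_Units)

lemma (in field) int_pow_mult_pow:
  assumes "x \<in> carrier R - {\<zero>}"
  shows "(x [^] (m :: int)) [^] (n :: int) = x [^] (m * n)"
  using group.int_pow_pow[OF units_group, of x m n] assms int_pow_nonzero[OF assms, of m]
  by (simp add: int_pow_units_of units_of_carrier units_of_mult field_Units)

lemma (in field) int_pow_mult_base:
  assumes "x \<in> carrier R - {\<zero>}" "y \<in> carrier R - {\<zero>}"
  shows "(x \<otimes> y) [^] (n :: int) = x [^] n \<otimes> y [^] n"
proof -
  have "x \<otimes> y \<in> carrier R - {\<zero>}"
    using assms integral_iff by auto
  then show ?thesis
    using comm_group.int_pow_distrib[OF units_comm_group, of x y n] assms
    by (simp add: int_pow_units_of units_of_carrier units_of_mult field_Units)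
qed

lemma (in field) int_pow_minus_one:
  assumes "x \<in> carrier R - {\<zero>}"
  shows "x [^] (- 1 :: int) = inv x"
  using assms by (simp add: int_pow_def2)

lemma (in field) int_pow_one_exp:
  assumes "x \<in> carrier R"
  shows "x [^] (1 :: int) = x"
  using assms by (simp add: int_pow_def2)

lemma (in field) nonzero_inv:
  assumes "x \<in> carrier R - {\<zero>}"
  shows "inv x \<in> carrier R - {\<zero>}" "x \<otimes> inv x = \<one>" "inv x \<otimes> x = \<one>" "inv (inv x) = x"
  using assms field_Units Units_inv_Units[of x] Units_r_inv[of x] Units_l_inv[of x] Units_inv_inv[of x]
  by auto

lemma (in field) nonzero_mult:
  assumes "x \<in> carrier R - {\<zero>}" "y \<in> carrier R - {\<zero>}"
  shows "x \<otimes> y \<in> carrier R - {\<zero>}"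
  using assms integral_iff by auto

lemma (in field) inv_mult:
  assumes "x \<in> carrier R - {\<zero>}" "y \<in> carrier R - {\<zero>}"
  shows "inv (x \<otimes> y) = inv x \<otimes> inv y"
proof (rule inv_char)
  show "x \<otimes> y \<otimes> (inv x \<otimes> inv y) = \<one>"
  proof -
    have "x \<otimes> y \<otimes> (inv x \<otimes> inv y) = (x \<otimes> inv x) \<otimes> (y \<otimes> inv y)"
      using assms nonzero_inv(1)[OF assms(1)] nonzero_inv(1)[OF assms(2)] by (simp add: m_ac)
    then show ?thesis using assms nonzero_inv by simp
  qed
  then show "inv x \<otimes> inv y \<otimes> (x \<otimes> y) = \<one>"
    using assms nonzero_inv(1)[OF assms(1)] nonzero_inv(1)[OF assms(2)] by (simp add: m_comm)
qed (use assms nonzero_inv in auto)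

lemma (in field) subring_Units_iff:
  assumes "subring V R"
  shows "x \<in> Units (R\<lparr>carrier := V\<rparr>) \<longleftrightarrow> x \<in> V \<and> x \<noteq> \<zero> \<and> inv x \<in> V"
proof
  assume "x \<in> Units (R\<lparr>carrier := V\<rparr>)"
  then obtain y where y: "x \<in> V" "y \<in> V" "y \<otimes> x = \<one>" "x \<otimes> y = \<one>"
    by (auto simp: Units_def)
  have c: "x \<in> carrier R" "y \<in> carrier R"
    using y subringE(1)[OF assms] by auto
  have "inv x = y"
    using c y by (intro inv_char) auto
  moreover have "x \<noteq> \<zero>"
    using c y by auto
  ultimately show "x \<in> V \<and> x \<noteq> \<zero> \<and> inv x \<in> V"
    using y by simp
next
  assume "x \<in> V \<and> x \<noteq> \<zero> \<and> inv x \<in> V"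
  then show "x \<in> Units (R\<lparr>carrier := V\<rparr>)"
    using nonzero_inv[of x] subringE(1)[OF assms] by (auto simp: Units_def)
qed

lemma (in field) subring_is_cring:
  assumes "subring V R"
  shows "cring (R\<lparr>carrier := V\<rparr>)"
  using subcring_iff[OF subringE(1)[OF assms]] subcringI'[OF assms] by simp

lemma (in ring) finsum_in_ideal_of_subring:
  assumes "subring V R" "ideal N (R\<lparr>carrier := V\<rparr>)" "finite J" "\<And>j. j \<in> J \<Longrightarrow> g j \<in> N"
  shows "(\<Oplus>j\<in>J. g j) \<in> N"
  using assms(3,4)
proof (induction J rule: finite_induct)
  case empty
  then show ?case
    using additive_subgroup.zero_closed[OF ideal.axioms(1)[OF assms(2)]] by simp
next
  case (insert j J)
  have "N \<subseteq> carrier R"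
    using ideal.Icarr[OF assms(2)] subringE(1)[OF assms(1)] by auto
  then have "(\<Oplus>i\<in>insert j J. g i) = g j \<oplus> (\<Oplus>i\<in>J. g i)"
    using insert by (intro finsum_insert) auto
  then show ?case
    using insert additive_subgroup.a_closed[OF ideal.axioms(1)[OF assms(2)]] by simp
qed

context field
begin

definition unit_times_power :: "'a set \<Rightarrow> 'a \<Rightarrow> 'a \<Rightarrow> bool" where
  "unit_times_power V t h \<longleftrightarrow>
     (\<exists>u (n::int). u \<in> Units (R\<lparr>carrier := V\<rparr>) \<and> h = u \<otimes> t [^] n)"

lemma subring_Units_carrier:
  assumes "subring V R" "u \<in> Units (R\<lparr>carrier := V\<rparr>)"
  shows "u \<in> V" "u \<in> carrier R - {\<zero>}" "inv u \<in> Units (R\<lparr>carrier := V\<rparr>)"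
proof -
  show "u \<in> V" and nz: "u \<in> carrier R - {\<zero>}"
    using assms subring_Units_iff[OF assms(1)] subringE(1)[OF assms(1)] by auto
  show "inv u \<in> Units (R\<lparr>carrier := V\<rparr>)"
    using assms subring_Units_iff[OF assms(1)] nonzero_inv[OF nz] by auto
qed

lemma subring_Units_mult:
  assumes "subring V R" "u \<in> Units (R\<lparr>carrier := V\<rparr>)" "v \<in> Units (R\<lparr>carrier := V\<rparr>)"
  shows "u \<otimes> v \<in> Units (R\<lparr>carrier := V\<rparr>)"
proof -
  interpret V: cring "R\<lparr>carrier := V\<rparr>"
    by (rule subring_is_cring[OF assms(1)])
  show ?thesis
    using V.Units_m_closed[OF assms(2,3)] by simp
qed

lemma unit_times_power_unit:
  assumes "subring V R" "u \<in> Units (R\<lparr>carrier := V\<rparr>)"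
  shows "unit_times_power V t u"
  unfolding unit_times_power_def using subring_Units_carrier[OF assms] assms(2)
  by (intro exI[of _ u] exI[of _ "0::int"]) auto

lemma unit_times_power_int_pow:
  assumes "subring V R" "t \<in> carrier R - {\<zero>}"
  shows "unit_times_power V t (t [^] (n::int))"
  unfolding unit_times_power_def
  using subring_Units_iff[OF assms(1), of \<one>] subringE(3)[OF assms(1)] int_pow_nonzero[OF assms(2), of n]
  by (intro exI[of _ \<one>] exI[of _ n]) auto

lemma unit_times_power_mult:
  assumes V: "subring V R" and t: "t \<in> carrier R - {\<zero>}"
    and "unit_times_power V t g" "unit_times_power V t h"
  shows "unit_times_power V t (g \<otimes> h)"
proof -
  obtain u m v n where uv: "u \<in> Units (R\<lparr>carrier := V\<rparr>)" "g = u \<otimes> t [^] (m::int)"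
      "v \<in> Units (R\<lparr>carrier := V\<rparr>)" "h = v \<otimes> t [^] (n::int)"
    using assms(3,4) unfolding unit_times_power_def by blast
  have "g \<otimes> h = (u \<otimes> v) \<otimes> t [^] (m + n)"
    unfolding uv(2,4) int_pow_add[OF t]
    using subring_Units_carrier(2)[OF V uv(1)] subring_Units_carrier(2)[OF V uv(3)]
      int_pow_nonzero[OF t, of m] int_pow_nonzero[OF t, of n]
    by (simp add: m_ac)
  then show ?thesis
    unfolding unit_times_power_def using subring_Units_mult[OF V uv(1,3)] by blast
qed

end

text \<open>
  The valuation is encoded by its effect: \<open>n\<close> in \<open>h = u t\<^sup>n\<close> is the order of \<open>h\<close>, and it is well defined
  because \<open>t\<close> is not invertible in \<open>V\<close>.
\<close>

locale discrete_valuation_subring = field R for R (structure) +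
  fixes V t
  assumes subring: "subring V R"
    and t_in: "t \<in> V" and t_nonzero: "t \<noteq> \<zero>" and inv_t_notin: "inv t \<notin> V"
    and unit_times_power: "\<And>h. \<lbrakk>h \<in> carrier R; h \<noteq> \<zero>\<rbrakk> \<Longrightarrow> unit_times_power V t h"
begin

lemma V_carrier: "x \<in> V \<Longrightarrow> x \<in> carrier R"
  using subringE(1)[OF subring] by auto

lemma t_carrier: "t \<in> carrier R - {\<zero>}"
  using t_in t_nonzero V_carrier by auto

lemma cring_V: "cring (R\<lparr>carrier := V\<rparr>)"
  by (rule subring_is_cring[OF subring])

abbreviation "V_units \<equiv> Units (R\<lparr>carrier := V\<rparr>)"

lemmas V_units_mult = subring_Units_mult[OF subring]
lemmas V_units_nonzero = subring_Units_carrier(2)[OF subring]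
lemmas V_units_inv = subring_Units_carrier(3)[OF subring]

lemma factorization:
  assumes "h \<in> carrier R" "h \<noteq> \<zero>"
  obtains u n where "u \<in> V_units" "h = u \<otimes> t [^] (n::int)"
  using unit_times_power[OF assms] unfolding unit_times_power_def by blast

lemma V_nat_pow: "x \<in> V \<Longrightarrow> x [^] (n::nat) \<in> V"
  by (induction n) (auto simp: subringE[OF subring])

lemma V_units_int_pow: "u \<in> V_units \<Longrightarrow> u [^] (n::int) \<in> V_units"
proof -
  assume u: "u \<in> V_units"
  have "u [^] k \<in> V_units" for k :: nat
  proof (induction k)
    case 0
    show ?case
      using subring_Units_iff[OF subring] subringE(3)[OF subring] by simp
  qed (use u V_units_mult in simp)
  then show ?thesis
    using V_units_inv[of "u [^] nat (- n)"] by (simp add: int_pow_def2 del: pow_nat)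
qed

lemma unit_times_pow_in_V_iff:
  assumes u: "u \<in> V_units"
  shows "u \<otimes> t [^] (n::int) \<in> V \<longleftrightarrow> 0 \<le> n"
proof
  assume "0 \<le> n"
  then have "t [^] n \<in> V"
    using V_nat_pow[OF t_in, of "nat n"] by (simp add: int_pow_def2 del: pow_nat)
  then show "u \<otimes> t [^] n \<in> V"
    using u subring_Units_iff[OF subring] subringE(6)[OF subring] by auto
next
  assume in_V: "u \<otimes> t [^] n \<in> V"
  show "0 \<le> n"
  proof (rule ccontr)
    assume "\<not> 0 \<le> n"
    then have "t [^] (- 1 - n) \<in> V"
      using V_nat_pow[OF t_in, of "nat (- 1 - n)"] by (simp add: int_pow_def2 del: pow_nat)
    moreover have "t [^] n \<in> V"
    proof -
      have "inv u \<otimes> (u \<otimes> t [^] n) \<in> V"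
        using in_V u subring_Units_iff[OF subring] subringE(6)[OF subring] by auto
      moreover have "inv u \<otimes> (u \<otimes> t [^] n) = t [^] n"
        using V_units_nonzero[OF u] nonzero_inv[of u] int_pow_nonzero[OF t_carrier, of n]
        by (simp flip: m_assoc)
      ultimately show ?thesis by simp
    qed
    ultimately have "t [^] (- 1 - n + n) \<in> V"
      unfolding int_pow_add[OF t_carrier] using subringE(6)[OF subring] by auto
    then show False
      using inv_t_notin int_pow_minus_one[OF t_carrier] by simp
  qed
qed

lemma inv_unit_times_pow:
  assumes u: "u \<in> V_units"
  shows "inv (u \<otimes> t [^] (n::int)) = inv u \<otimes> t [^] (- n)"
proof -
  have "t [^] n \<otimes> t [^] (- n) = \<one>"
    by (simp flip: int_pow_add[OF t_carrier])
  then have "inv (t [^] n) = t [^] (- n)"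
    using int_pow_nonzero[OF t_carrier] by (intro inv_char) (auto simp: m_comm)
  then show ?thesis
    using inv_mult[of u "t [^] n"] V_units_nonzero[OF u] int_pow_nonzero[OF t_carrier] by auto
qed

lemma unit_times_pow_unit_iff:
  assumes u: "u \<in> V_units"
  shows "u \<otimes> t [^] (n::int) \<in> V_units \<longleftrightarrow> n = 0"
  using subring_Units_iff[OF subring, of "u \<otimes> t [^] n"] unit_times_pow_in_V_iff[OF u, of n]
    unit_times_pow_in_V_iff[OF V_units_inv[OF u], of "- n"] inv_unit_times_pow[OF u, of n]
    nonzero_mult[OF V_units_nonzero[OF u] int_pow_nonzero[OF t_carrier, of n]]
  by auto

lemma exponent_unique:
  assumes "u \<in> V_units" "v \<in> V_units" "u \<otimes> t [^] (m::int) = v \<otimes> t [^] n"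
  shows "m = n"
proof -
  have c: "u \<in> carrier R" "v \<in> carrier R" "inv v \<in> carrier R"
    "t [^] m \<in> carrier R" "t [^] n \<in> carrier R" "t [^] (- n) \<in> carrier R"
    using assms V_units_nonzero nonzero_inv[of v] int_pow_nonzero[OF t_carrier] by auto
  have "(inv v \<otimes> u) \<otimes> t [^] (m - n) = inv v \<otimes> (u \<otimes> t [^] m) \<otimes> t [^] (- n)"
    using c int_pow_add[OF t_carrier, of m "- n"] by (simp add: m_assoc)
  also have "\<dots> = (inv v \<otimes> v) \<otimes> (t [^] n \<otimes> t [^] (- n))"
    unfolding assms(3) using c by (simp add: m_assoc)
  also have "\<dots> = \<one>"
    using V_units_nonzero[OF assms(2)] nonzero_inv(3)[of v]
    by (simp flip: int_pow_add[OF t_carrier])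
  finally have "(inv v \<otimes> u) \<otimes> t [^] (m - n) \<in> V_units"
    using subring_Units_iff[OF subring] subringE(3)[OF subring] by simp
  then show ?thesis
    using unit_times_pow_unit_iff[OF V_units_mult[OF V_units_inv[OF assms(2)] assms(1)]] by simp
qed

text \<open>
  A non-unit of \<open>V\<close> is a unit times a positive power of \<open>t\<close>; hence \<open>t V\<close> consists of
  exactly the non-units, and \<open>V\<close> is a local ring.
\<close>

lemma generated_by_t: "PIdl\<^bsub>R\<lparr>carrier := V\<rparr>\<^esub> t = V - V_units"
proof (intro equalityI subsetI)
  fix x assume "x \<in> PIdl\<^bsub>R\<lparr>carrier := V\<rparr>\<^esub> t"
  then obtain y where y: "y \<in> V" "x = y \<otimes> t"
    by (auto simp: cgenideal_def)
  have "inv t \<in> V" if "x \<in> V_units"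
  proof -
    have "x \<noteq> \<zero>" "inv x \<in> V"
      using that subring_Units_iff[OF subring] by auto
    have "(y \<otimes> inv x) \<otimes> t = \<one>"
      using y that V_units_nonzero nonzero_inv(1,2)[of x] V_carrier t_in
      by (metis DiffD1 m_assoc m_comm)
    then have "inv t = y \<otimes> inv x"
      using y \<open>inv x \<in> V\<close> V_carrier t_in by (intro inv_char) (auto simp: m_comm)
    then show ?thesis
      using y \<open>inv x \<in> V\<close> subringE(6)[OF subring] by simp
  qed
  then show "x \<in> V - V_units"
    using y t_in inv_t_notin subringE(6)[OF subring] by auto
next
  fix x assume x: "x \<in> V - V_units"
  show "x \<in> PIdl\<^bsub>R\<lparr>carrier := V\<rparr>\<^esub> t"
  proof (cases "x = \<zero>")
    case True
    then have "x = \<zero> \<otimes> t"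
      using t_carrier by simp
    then show ?thesis
      using subringE(2)[OF subring] unfolding cgenideal_def by auto
  next
    case False
    obtain u n where u: "u \<in> V_units" "x = u \<otimes> t [^] (n::int)"
      using factorization[of x] False x V_carrier by blast
    have "1 \<le> n"
      using u x unit_times_pow_in_V_iff[OF u(1), of n] unit_times_pow_unit_iff[OF u(1), of n] by auto
    have "x = (u \<otimes> t [^] (n - 1)) \<otimes> t"
      using int_pow_add[OF t_carrier, of "n - 1" 1] u V_units_nonzero[OF u(1)] t_carrier
        int_pow_nonzero[OF t_carrier] int_pow_one_exp[of t]
      by (simp add: m_assoc)
    moreover have "u \<otimes> t [^] (n - 1) \<in> V"
      using \<open>1 \<le> n\<close> unit_times_pow_in_V_iff[OF u(1)] by simp
    ultimately show ?thesis
      unfolding cgenideal_def by auto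
  qed
qed

lemma nonunits_ideal: "ideal (V - V_units) (R\<lparr>carrier := V\<rparr>)"
  using cring.cgenideal_ideal[OF cring_V, of t] t_in generated_by_t by simp

lemma one_V_unit: "\<one> \<in> V_units"
  using subring_Units_iff[OF subring] subringE(3)[OF subring] by simp

lemma ideal_with_unit:
  assumes "ideal J (R\<lparr>carrier := V\<rparr>)" "u \<in> J" "u \<in> V_units"
  shows "J = V"
proof -
  have "inv u \<otimes> u \<in> J"
    using ideal.I_l_closed[OF assms(1), of u "inv u"] assms subring_Units_iff[OF subring] by simp
  then have "\<one> \<in> J"
    using nonzero_inv(3)[OF V_units_nonzero[OF assms(3)]] by simp
  then show ?thesis
    using ideal.one_imp_carrier[OF assms(1)] by simp
qed

lemma maximalideal_nonunits: "maximalideal (V - V_units) (R\<lparr>carrier := V\<rparr>)"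
proof (rule maximalidealI[OF nonunits_ideal])
  show "carrier (R\<lparr>carrier := V\<rparr>) \<noteq> V - V_units"
    using one_V_unit subringE(3)[OF subring] by auto
  fix J assume J: "ideal J (R\<lparr>carrier := V\<rparr>)" "V - V_units \<subseteq> J" "J \<subseteq> carrier (R\<lparr>carrier := V\<rparr>)"
  then show "J = V - V_units \<or> J = carrier (R\<lparr>carrier := V\<rparr>)"
    using ideal_with_unit[OF J(1)] by auto
qed

lemma maximalideal_unique:
  assumes "maximalideal m (R\<lparr>carrier := V\<rparr>)"
  shows "m = V - V_units"
proof -
  interpret m: maximalideal m "R\<lparr>carrier := V\<rparr>" by fact
  have "m \<subseteq> V - V_units"
    using ideal_with_unit[OF m.ideal_axioms] m.I_notcarr m.Icarr by auto
  then have "V - V_units = m \<or> V - V_units = V"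
    using m.I_maximal[OF nonunits_ideal] by auto
  then show ?thesis
    using one_V_unit subringE(3)[OF subring] by auto
qed

end

lemma localization_atI:
  "a \<in> A \<Longrightarrow> b \<in> A \<Longrightarrow> b \<notin> m \<Longrightarrow> a \<otimes>\<^bsub>K\<^esub> inv\<^bsub>K\<^esub> b \<in> localization_at K A m"
  by (auto simp: localization_at_def)

context discrete_valuation_subring
begin

lemma localization_at_nonunits: "localization_at R V (V - V_units) = V"
proof (intro equalityI subsetI)
  fix x assume "x \<in> localization_at R V (V - V_units)"
  then obtain a b where "a \<in> V" "b \<in> V_units" "x = a \<otimes> inv b"
    by (auto simp: localization_at_def)
  then show "x \<in> V"
    using subring_Units_iff[OF subring] subringE(6)[OF subring] by auto
next
  fix x assume x: "x \<in> V"
  then have "x \<otimes> inv \<one> \<in> localization_at R V (V - V_units)"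
    using one_V_unit subringE(3)[OF subring] by (intro localization_atI) auto
  then show "x \<in> localization_at R V (V - V_units)"
    using x V_carrier by simp
qed

lemma inv_notin_imp_nonunit:
  assumes "h \<in> carrier R" "h \<notin> V"
  shows "h \<noteq> \<zero>" "inv h \<in> V - V_units"
proof -
  show nz: "h \<noteq> \<zero>"
    using assms subringE(2)[OF subring] by auto
  obtain u n where u: "u \<in> V_units" "h = u \<otimes> t [^] (n::int)"
    using factorization[OF assms(1) nz] by blast
  then have "n < 0"
    using assms unit_times_pow_in_V_iff[OF u(1), of n] by simp
  then show "inv h \<in> V - V_units"
    using inv_unit_times_pow[OF u(1), of n] unit_times_pow_in_V_iff[OF V_units_inv[OF u(1)], of "- n"]
      unit_times_pow_unit_iff[OF V_units_inv[OF u(1)], of "- n"] u(2) by simp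
qed

text \<open>
  If \<open>h\<close> lies outside \<open>V\<close>, then \<open>1/h\<close> is a non-unit of \<open>V\<close>. Dividing an integral equation
  of degree \<open>n\<close> for \<open>h\<close> by \<open>h\<^sup>n\<close> would write \<open>1\<close> as a combination of powers of \<open>1/h\<close>, hence
  as a non-unit.
\<close>

lemma integrally_closed:
  assumes "A \<subseteq> V"
  shows "integral_closure_in R A \<subseteq> V"
proof
  fix h assume "h \<in> integral_closure_in R A"
  then obtain n :: nat and c where h: "h \<in> carrier R" and c: "c \<in> {..<n} \<rightarrow> A"
    and eq: "h [^] n \<oplus> (\<Oplus>j\<in>{..<n}. c j \<otimes> h [^] j) = \<zero>"
    unfolding integral_closure_in_def by blast
  show "h \<in> V"
  proof (rule ccontr)
    assume "h \<notin> V"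
    define g where "g = inv h"
    have nz: "h \<in> carrier R - {\<zero>}" and gN: "g \<in> V - V_units"
      using inv_notin_imp_nonunit[OF h \<open>h \<notin> V\<close>] h g_def by auto
    have g: "g \<in> carrier R" "h \<otimes> g = \<one>"
      using nonzero_inv[OF nz] g_def by auto
    have cc: "c j \<in> V" "c j \<in> carrier R" if "j < n" for j
      using c that assms V_carrier by auto
    have hg: "h [^] j \<otimes> g [^] j = \<one>" for j :: nat
      using pow_mult_distrib[of h g j] g h by (simp add: m_comm)
    have summand: "(c j \<otimes> h [^] j) \<otimes> g [^] n = c j \<otimes> g [^] (n - j)" if "j < n" for j
    proof -
      have "g [^] n = g [^] j \<otimes> g [^] (n - j)"
        using that g by (simp add: nat_pow_mult)
      then have "(c j \<otimes> h [^] j) \<otimes> g [^] n = c j \<otimes> ((h [^] j \<otimes> g [^] j) \<otimes> g [^] (n - j))"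
        using cc[OF that] g h by (simp add: m_assoc)
      then show ?thesis
        using g by (simp add: hg)
    qed
    have termN: "c j \<otimes> g [^] (n - j) \<in> V - V_units" if "j < n" for j
    proof -
      have "g [^] (n - j) = g [^] (n - j - 1) \<otimes> g"
        using that by (cases "n - j") (auto simp: nat_pow_Suc)
      then have "c j \<otimes> g [^] (n - j) = (c j \<otimes> g [^] (n - j - 1)) \<otimes> g"
        using cc[OF that] g by (simp add: m_assoc)
      moreover have "c j \<otimes> g [^] (n - j - 1) \<in> V"
        using cc[OF that] V_nat_pow[of g] gN subringE(6)[OF subring] by simp
      ultimately show ?thesis
        using ideal.I_l_closed[OF nonunits_ideal gN] by simp
    qed
    have "(\<Oplus>j\<in>{..<n}. c j \<otimes> h [^] j) \<otimes> g [^] n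
        = (\<Oplus>j\<in>{..<n}. (c j \<otimes> h [^] j) \<otimes> g [^] n)"
      using cc h g by (intro finsum_ldistr) auto
    also have "\<dots> = (\<Oplus>j\<in>{..<n}. c j \<otimes> g [^] (n - j))"
      using cc g by (intro finsum_cong') (auto simp: summand)
    finally have sum_eq: "(\<Oplus>j\<in>{..<n}. c j \<otimes> h [^] j) \<otimes> g [^] n
        = (\<Oplus>j\<in>{..<n}. c j \<otimes> g [^] (n - j))" .
    define s where "s = (\<Oplus>j\<in>{..<n}. c j \<otimes> g [^] (n - j))"
    have sN: "s \<in> V - V_units"
      unfolding s_def using termN by (intro finsum_in_ideal_of_subring[OF subring nonunits_ideal]) auto
    have S: "(\<Oplus>j\<in>{..<n}. c j \<otimes> h [^] j) \<in> carrier R"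
      using cc h by (intro finsum_closed) auto
    have "(h [^] n \<oplus> (\<Oplus>j\<in>{..<n}. c j \<otimes> h [^] j)) \<otimes> g [^] n = \<one> \<oplus> s"
      using S g h by (simp add: l_distr hg sum_eq s_def)
    then have "\<one> \<oplus> s = \<zero>"
      using eq g by simp
    then have "\<ominus> s = \<one>"
      using sN V_carrier by (metis DiffD1 minus_equality one_closed)
    moreover have "\<ominus> s \<in> V - V_units"
    proof -
      have "(\<ominus> \<one>) \<otimes> s \<in> V - V_units"
        using ideal.I_l_closed[OF nonunits_ideal sN, of "\<ominus> \<one>"] subringE(3,5)[OF subring] by simp
      then show ?thesis
        using sN V_carrier by (simp add: l_minus)
    qed
    ultimately show False
      using one_V_unit by simp
  qed
qed

text \<open>Any two generators of the maximal ideal differ by a unit, so they measure the same order.\<close>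

lemma exponent_unique_generators:
  assumes t': "t' \<in> V" "maximalideal (PIdl\<^bsub>R\<lparr>carrier := V\<rparr>\<^esub> t') (R\<lparr>carrier := V\<rparr>)"
    and uv: "u \<in> V_units" "v \<in> V_units"
    and eq: "u \<otimes> t' [^] (m::int) = v \<otimes> t [^] (n::int)"
  shows "m = n"
proof -
  have same: "PIdl\<^bsub>R\<lparr>carrier := V\<rparr>\<^esub> t' = PIdl\<^bsub>R\<lparr>carrier := V\<rparr>\<^esub> t"
    using maximalideal_unique[OF t'(2)] generated_by_t by simp
  moreover have self: "s \<in> PIdl\<^bsub>R\<lparr>carrier := V\<rparr>\<^esub> s" if "s \<in> V" for s
    using cring.axioms(1)[OF cring_V] ring.cgenideal_self[of "R\<lparr>carrier := V\<rparr>" s] that by simp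
  ultimately have "t \<in> PIdl\<^bsub>R\<lparr>carrier := V\<rparr>\<^esub> t'" "t' \<in> PIdl\<^bsub>R\<lparr>carrier := V\<rparr>\<^esub> t"
    using t_in t' by auto
  then obtain a b where ab: "a \<in> V" "b \<in> V" "t = a \<otimes> t'" "t' = b \<otimes> t"
    by (auto simp: cgenideal_def)
  have nz: "a \<in> carrier R - {\<zero>}" "b \<in> carrier R - {\<zero>}"
    using ab V_carrier t_carrier t'(1) by fastforce+
  have "(a \<otimes> b) \<otimes> t = \<one> \<otimes> t"
    using ab V_carrier t_carrier by (metis DiffD1 l_one m_assoc)
  then have "a \<otimes> b = \<one>"
    using m_rcancel[of t "a \<otimes> b" \<one>] t_carrier nz by auto
  then have "inv b = a"
    using nz by (intro inv_char) (auto simp: m_comm)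
  then have b: "b \<in> V_units"
    using subring_Units_iff[OF subring] ab nz by simp
  have "u \<otimes> t' [^] m = (u \<otimes> b [^] m) \<otimes> t [^] m"
    using int_pow_mult_base[OF nz(2) t_carrier, of m] ab(4) V_units_nonzero[OF uv(1)]
      int_pow_nonzero[OF nz(2), of m] int_pow_nonzero[OF t_carrier, of m] by (simp add: m_assoc)
  then show "m = n"
    using exponent_unique[OF V_units_mult[OF uv(1) V_units_int_pow[OF b]] uv(2), of m m n] eq by simp
qed

lemma factor_exponent_ge:
  assumes "h \<in> carrier R" "h \<noteq> \<zero>" "w \<in> V" "h = w \<otimes> t [^] (n::int)"
  obtains u m where "u \<in> V_units" "h = u \<otimes> t [^] (m::int)" "n \<le> m"
proof -
  have "w \<noteq> \<zero>"
    using assms int_pow_nonzero[OF t_carrier, of n] by auto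
  then obtain u m where u: "u \<in> V_units" "w = u \<otimes> t [^] (m::int)"
    using factorization[of w] assms(3) V_carrier by blast
  have "0 \<le> m"
    using unit_times_pow_in_V_iff[OF u(1), of m] u assms by simp
  moreover have "h = u \<otimes> t [^] (m + n)"
    unfolding assms(4) u(2) using V_units_nonzero[OF u(1)] int_pow_nonzero[OF t_carrier]
    by (simp add: int_pow_add[OF t_carrier] m_assoc)
  ultimately show ?thesis
    using that[OF u(1), of "m + n"] by simp
qed

end

text \<open>
  A discrete valuation ring has only one maximal ideal and equals its localization there. So if the
  integral closure of the local ring of the plane curve is one, then it is the local ring of the
  normalization at \<open>P\<close>, and the order of vanishing is the exponent of any uniformizer.
\<close>

lemma vanishing_order_ge:
  assumes P: "P \<in> normalized_curve f"
    and dvr: "discrete_valuation_subring (function_field f) (normalized_local_ring f (fst P)) t"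
    and w: "w \<in> normalized_local_ring f (fst P)" "w \<noteq> \<zero>\<^bsub>function_field f\<^esub>"
    and h: "h = w \<otimes>\<^bsub>function_field f\<^esub> t [^]\<^bsub>function_field f\<^esub> (n::int)"
  shows "n \<le> vanishing_order f P h"
proof -
  define V where "V = normalized_local_ring f (fst P)"
  interpret discrete_valuation_subring "function_field f" V t
    using dvr by (simp add: V_def)
  let ?K = "function_field f"
  have h_carrier: "h \<in> carrier ?K" "h \<noteq> \<zero>\<^bsub>?K\<^esub>"
    using nonzero_mult[OF _ int_pow_nonzero[OF t_carrier, of n], of w] w V_carrier
    unfolding h V_def by auto
  obtain p m where pm: "P = (p, m)"
    by fastforce
  have "maximalideal m (?K\<lparr>carrier := V\<rparr>)"
    using P unfolding normalized_curve_def pm V_def by simp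
  then have "snd P = V - V_units"
    using maximalideal_unique pm by simp
  then have ring: "point_ring f P = ?K\<lparr>carrier := V\<rparr>"
    unfolding point_ring_def using localization_at_nonunits by (simp flip: V_def)
  have uni_t: "uniformizer f P t"
    unfolding uniformizer_def ring generated_by_t using maximalideal_nonunits t_in by simp
  obtain u k where u: "u \<in> V_units" "h = u \<otimes>\<^bsub>?K\<^esub> t [^]\<^bsub>?K\<^esub> (k::int)" "n \<le> k"
    using factor_exponent_ge[OF h_carrier _ h] w V_def by blast
  have "vanishing_order f P h = k"
    unfolding vanishing_order_def
  proof (rule the_equality)
    show "\<exists>t u. uniformizer f P t \<and> u \<in> Units (point_ring f P) \<and>
        h = u \<otimes>\<^bsub>?K\<^esub> t [^]\<^bsub>?K\<^esub> k"
      using uni_t u ring by auto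
  next
    fix l :: int assume "\<exists>t u. uniformizer f P t \<and> u \<in> Units (point_ring f P) \<and>
        h = u \<otimes>\<^bsub>?K\<^esub> t [^]\<^bsub>?K\<^esub> l"
    then obtain t' v where "uniformizer f P t'" "v \<in> V_units" "h = v \<otimes>\<^bsub>?K\<^esub> t' [^]\<^bsub>?K\<^esub> l"
      using ring by auto
    then show "l = k"
      using exponent_unique_generators[of t' v u l k] u unfolding uniformizer_def ring by simp
  qed
  then show ?thesis
    using u by simp
qed

section \<open>Localization of an algebra at a rational point\<close>

text \<open>
  A subring \<open>A\<close> of a field with an ideal \<open>M\<close> such that every element of \<open>A\<close> has a residue in the
  constants \<open>C\<close>. This is the situation of a coordinate ring over \<open>C\<close> and a point on an
  affine chart with coordinates in \<open>C\<close>.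
\<close>

locale rational_point = field R for R (structure) +
  fixes C A M
  assumes A_subring: "subring A R"
    and C_subset: "C \<subseteq> A"
    and C_inverse: "\<And>c. c \<in> C \<Longrightarrow> c \<noteq> \<zero> \<Longrightarrow> inv c \<in> C"
    and C_mult: "\<And>c d. c \<in> C \<Longrightarrow> d \<in> C \<Longrightarrow> c \<otimes> d \<in> C"
    and M_ideal: "ideal M (R\<lparr>carrier := A\<rparr>)"
    and residue: "\<And>a. a \<in> A \<Longrightarrow> \<exists>c\<in>C. \<exists>x\<in>M. a = c \<oplus> x"
begin

lemma A_carrier: "x \<in> A \<Longrightarrow> x \<in> carrier R"
  using subringE(1)[OF A_subring] by auto

lemma M_subset: "x \<in> M \<Longrightarrow> x \<in> A"
  using ideal.Icarr[OF M_ideal] by simp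

lemma M_mult: "a \<in> A \<Longrightarrow> x \<in> M \<Longrightarrow> a \<otimes> x \<in> M"
  using ideal.I_l_closed[OF M_ideal] by simp

lemma M_add: "x \<in> M \<Longrightarrow> y \<in> M \<Longrightarrow> x \<oplus> y \<in> M"
  using additive_subgroup.a_closed[OF ideal.axioms(1)[OF M_ideal]] by simp

lemma M_zero: "\<zero> \<in> M"
  using additive_subgroup.zero_closed[OF ideal.axioms(1)[OF M_ideal]] by simp

lemma M_diff: "x \<in> M \<Longrightarrow> y \<in> M \<Longrightarrow> x \<ominus> y \<in> M"
proof -
  assume xy: "x \<in> M" "y \<in> M"
  have "(\<ominus> \<one>) \<otimes> y \<in> M"
    using M_mult[OF _ xy(2)] subringE(3,5)[OF A_subring] by blast
  then show "x \<ominus> y \<in> M"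
    using M_add xy A_carrier M_subset by (simp add: l_minus minus_eq)
qed

lemma localization_empty:
  assumes "\<one> \<in> M"
  shows "localization_at R A M = {}"
  using ideal.one_imp_carrier[OF M_ideal] assms by (auto simp: localization_at_def)

end

locale proper_rational_point = rational_point +
  assumes one_notin: "\<one> \<notin> M"
begin

abbreviation "L \<equiv> localization_at R A M"

lemma C_M_zero: "c \<in> C \<Longrightarrow> c \<in> M \<Longrightarrow> c = \<zero>"
proof (rule ccontr)
  assume c: "c \<in> C" "c \<in> M" "c \<noteq> \<zero>"
  then have "inv c \<otimes> c \<in> M"
    using C_inverse C_subset M_mult by auto
  then show False
    using nonzero_inv(3)[of c] c one_notin C_subset A_carrier by auto
qed

text \<open>The constant term of a product is the product of the constant terms.\<close>

lemma prime:
  assumes "a \<in> A - M" "b \<in> A - M"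
  shows "a \<otimes> b \<in> A - M"
proof -
  obtain c x where c: "c \<in> C" "x \<in> M" "a = c \<oplus> x"
    using residue assms by blast
  obtain d y where d: "d \<in> C" "y \<in> M" "b = d \<oplus> y"
    using residue assms by blast
  have "c \<noteq> \<zero>" "d \<noteq> \<zero>"
    using c d assms A_carrier M_subset by auto
  then have "c \<otimes> d \<noteq> \<zero>"
    using integral_iff[of c d] c(1) d(1) subsetD[OF C_subset] A_carrier by blast
  have carr: "c \<in> carrier R" "d \<in> carrier R" "x \<in> carrier R" "y \<in> carrier R" "a \<in> carrier R" "b \<in> carrier R"
    using c d C_subset A_carrier M_subset assms by auto
  have rest: "c \<otimes> y \<oplus> b \<otimes> x \<in> M"
    using c d C_subset assms by (intro M_add M_mult) auto
  have "a \<otimes> b = c \<otimes> d \<oplus> (c \<otimes> y \<oplus> b \<otimes> x)"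
    using carr(1-4) unfolding c(3) d(3) by (simp add: l_distr r_distr m_ac a_ac)
  then have "c \<otimes> d = a \<otimes> b \<ominus> (c \<otimes> y \<oplus> b \<otimes> x)"
    using carr by (simp add: minus_eq a_assoc r_neg)
  then have "c \<otimes> d \<in> M" if "a \<otimes> b \<in> M"
    using M_diff[OF that rest] by simp
  then show ?thesis
    using \<open>c \<otimes> d \<noteq> \<zero>\<close> C_M_zero C_mult c d assms subringE(6)[OF A_subring] by blast
qed

lemma outside_M_nonzero: "b \<in> A - M \<Longrightarrow> b \<in> carrier R - {\<zero>}"
  using A_carrier M_zero by auto

lemma A_subset_L: "a \<in> A \<Longrightarrow> a \<in> L"
  using localization_atI[of a A \<one> M R] one_notin subringE(3)[OF A_subring] A_carrier by simp

lemma inv_in_L: "b \<in> A - M \<Longrightarrow> inv b \<in> L"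
  using localization_atI[of \<one> A b M R] subringE(3)[OF A_subring] nonzero_inv[of b] outside_M_nonzero[of b]
  by simp

lemma L_cases:
  assumes "x \<in> L"
  obtains a b where "a \<in> A" "b \<in> A - M" "x = a \<otimes> inv b" "x \<in> carrier R" "a = x \<otimes> b"
proof -
  obtain a b where ab: "a \<in> A" "b \<in> A - M" "x = a \<otimes> inv b"
    using assms by (auto simp: localization_at_def)
  have "x \<otimes> b = a \<otimes> (inv b \<otimes> b)"
    using ab A_carrier outside_M_nonzero nonzero_inv(1)[of b] by (simp add: m_assoc)
  then have "a = x \<otimes> b"
    using ab A_carrier outside_M_nonzero nonzero_inv(3)[of b] by simp
  moreover have "x \<in> carrier R"
    using ab A_carrier outside_M_nonzero nonzero_inv(1)[of b] by simp
  ultimately show ?thesis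
    using that ab by blast
qed

lemma L_I:
  assumes "x \<in> carrier R" "b \<in> A - M" "x \<otimes> b \<in> A"
  shows "x \<in> L"
proof -
  have "x = (x \<otimes> b) \<otimes> inv b"
    using assms outside_M_nonzero nonzero_inv(1,2)[of b] by (simp add: m_assoc)
  then show ?thesis
    using localization_atI[of "x \<otimes> b" A b M R] assms by auto
qed

lemma L_subring: "subring L R"
proof (rule subringI)
  show "L \<subseteq> carrier R"
    using L_cases by blast
  show "\<one> \<in> L"
    using A_subset_L subringE(3)[OF A_subring] by simp
next
  fix x assume "x \<in> L"
  then obtain a b where "a \<in> A" "b \<in> A - M" "x \<in> carrier R" "a = x \<otimes> b"
    by (rule L_cases)
  then show "\<ominus> x \<in> L"
    using subringE(5)[OF A_subring, of a] outside_M_nonzero by (intro L_I[of _ b]) (auto simp: l_minus)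
next
  fix x y assume "x \<in> L" "y \<in> L"
  from \<open>x \<in> L\<close> obtain a b where x: "a \<in> A" "b \<in> A - M" "x \<in> carrier R" "a = x \<otimes> b"
    by (rule L_cases)
  from \<open>y \<in> L\<close> obtain c d where y: "c \<in> A" "d \<in> A - M" "y \<in> carrier R" "c = y \<otimes> d"
    by (rule L_cases)
  have bd: "b \<otimes> d \<in> A - M" "b \<in> carrier R" "d \<in> carrier R"
    using prime x y A_carrier by auto
  have "(x \<otimes> y) \<otimes> (b \<otimes> d) = a \<otimes> c"
    unfolding x(4) y(4) using x(3) y(3) bd by (simp add: m_ac)
  then show "x \<otimes> y \<in> L"
    using x y bd subringE(6)[OF A_subring] by (intro L_I[of _ "b \<otimes> d"]) auto
  have "(x \<oplus> y) \<otimes> (b \<otimes> d) = a \<otimes> d \<oplus> c \<otimes> b"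
    unfolding x(4) y(4) using x(3) y(3) bd by (simp add: m_ac l_distr r_distr)
  then show "x \<oplus> y \<in> L"
    using x y bd subringE(6,7)[OF A_subring] by (intro L_I[of _ "b \<otimes> d"]) auto
qed

text \<open>
  If \<open>c/d\<close> is the inverse of \<open>a/b\<close>, then \<open>a c = b d\<close>, which is outside \<open>M\<close> because \<open>M\<close> is prime. So the
  fractions with numerator in \<open>M\<close> are the non-units, and \<open>L\<close> is a local ring.
\<close>

lemma nonunit_L_iff:
  assumes "a \<in> A" "b \<in> A - M"
  shows "a \<otimes> inv b \<in> Units (R\<lparr>carrier := L\<rparr>) \<longleftrightarrow> a \<notin> M"
proof
  assume unit: "a \<otimes> inv b \<in> Units (R\<lparr>carrier := L\<rparr>)"
  have b: "b \<in> carrier R - {\<zero>}" "a \<in> carrier R" "inv b \<in> carrier R" "b \<otimes> inv b = \<one>"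
    using outside_M_nonzero[OF assms(2)] nonzero_inv[of b] assms A_carrier by auto
  show "a \<notin> M"
  proof
    assume "a \<in> M"
    have "a \<otimes> inv b \<noteq> \<zero>" "inv (a \<otimes> inv b) \<in> L"
      using unit subring_Units_iff[OF L_subring] by auto
    then obtain c d where cd: "c \<in> A" "d \<in> A - M" "inv (a \<otimes> inv b) \<in> carrier R"
        "c = inv (a \<otimes> inv b) \<otimes> d"
      by (meson L_cases)
    have d: "d \<in> carrier R"
      using cd A_carrier by auto
    have "a \<otimes> c = (b \<otimes> inv b) \<otimes> (a \<otimes> c)"
      using b cd(1) A_carrier by simp
    also have "\<dots> = ((a \<otimes> inv b) \<otimes> inv (a \<otimes> inv b)) \<otimes> (b \<otimes> d)"
      unfolding cd(4) using b(1-3) cd(3) d by (simp add: m_ac)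
    also have "\<dots> = b \<otimes> d"
      using nonzero_inv(2)[of "a \<otimes> inv b"] \<open>a \<otimes> inv b \<noteq> \<zero>\<close> b d by simp
    finally have "b \<otimes> d \<in> M"
      using M_mult[OF cd(1) \<open>a \<in> M\<close>] b cd(1) A_carrier by (simp add: m_comm)
    then show False
      using prime assms cd by blast
  qed
next
  assume "a \<notin> M"
  then have a: "a \<in> A - M"
    using assms by simp
  have nz: "a \<in> carrier R - {\<zero>}" "b \<in> carrier R - {\<zero>}"
    using a assms outside_M_nonzero by auto
  have "inv (a \<otimes> inv b) = inv a \<otimes> b"
    using inv_mult[OF nz(1) nonzero_inv(1)[OF nz(2)]] nonzero_inv(4)[OF nz(2)] by simp
  then show "a \<otimes> inv b \<in> Units (R\<lparr>carrier := L\<rparr>)"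
    using subring_Units_iff[OF L_subring] nonzero_mult[OF nz(1) nonzero_inv(1)[OF nz(2)]]
      inv_in_L[OF a] inv_in_L[OF assms(2)] A_subset_L subringE(6)[OF L_subring] assms by auto
qed

lemma nonunit_L_A: "a \<in> A \<Longrightarrow> a \<in> Units (R\<lparr>carrier := L\<rparr>) \<longleftrightarrow> a \<notin> M"
  using nonunit_L_iff[of a \<one>] one_notin subringE(3)[OF A_subring] A_carrier by simp

lemma nonunits_L_add:
  assumes "x \<in> L - Units (R\<lparr>carrier := L\<rparr>)" "y \<in> L - Units (R\<lparr>carrier := L\<rparr>)"
  shows "x \<oplus> y \<notin> Units (R\<lparr>carrier := L\<rparr>)"
proof -
  obtain a b where x: "a \<in> A" "b \<in> A - M" "x = a \<otimes> inv b"
    using assms by (meson DiffD1 L_cases)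
  obtain c d where y: "c \<in> A" "d \<in> A - M" "y = c \<otimes> inv d"
    using assms by (meson DiffD1 L_cases)
  have M: "a \<in> M" "c \<in> M"
    using nonunit_L_iff x y assms by auto
  have nz: "b \<in> carrier R - {\<zero>}" "d \<in> carrier R - {\<zero>}"
    using outside_M_nonzero x y by auto
  note n = nz[THEN nonzero_inv(1)] nz[THEN nonzero_inv(2)]
  have ac: "a \<in> carrier R" "c \<in> carrier R"
    using x y A_carrier by auto
  have "(d \<otimes> a \<oplus> b \<otimes> c) \<otimes> inv (b \<otimes> d) = (a \<otimes> inv b) \<otimes> (d \<otimes> inv d) \<oplus> (c \<otimes> inv d) \<otimes> (b \<otimes> inv b)"
    unfolding inv_mult[OF nz] using nz ac n(1,2) by (simp add: m_ac l_distr r_distr)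
  also have "\<dots> = x \<oplus> y"
    using n x y nz ac by simp
  finally have "x \<oplus> y = (d \<otimes> a \<oplus> b \<otimes> c) \<otimes> inv (b \<otimes> d)" ..
  moreover have "d \<otimes> a \<oplus> b \<otimes> c \<in> M"
    using M x y by (intro M_add M_mult) auto
  ultimately show ?thesis
    using nonunit_L_iff[OF _ prime[OF x(2) y(2)]] M_subset by metis
qed

end

text \<open>
  An element of the algebra generated by coordinates is a polynomial expression in them. Its residue
  modulo the ideal generated by the coordinates is its constant term.
\<close>

lemma (in field) rational_point_generate_ring:
  assumes C: "subfield C R" and S: "S \<subseteq> carrier R"
  defines "A \<equiv> generate_ring R (C \<union> S)"
  defines "M \<equiv> Idl\<^bsub>R\<lparr>carrier := A\<rparr>\<^esub> S"
  shows "rational_point R C A M" "S \<subseteq> M"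
proof -
  have CS: "C \<union> S \<subseteq> carrier R"
    using subringE(1) subfieldE(1)[OF C] subcring.axioms(1) S subfieldE(3)[OF C] by auto
  have A: "subring A R"
    unfolding A_def by (rule generate_ring_is_subring[OF CS])
  interpret A: cring "R\<lparr>carrier := A\<rparr>"
    by (rule subring_is_cring[OF A])
  have incl: "C \<subseteq> A" "S \<subseteq> A"
    unfolding A_def by (auto intro: generate_ring.incl)
  have M: "ideal M (R\<lparr>carrier := A\<rparr>)" "S \<subseteq> M"
    unfolding M_def using A.genideal_ideal[of S] A.genideal_self[of S] incl by auto
  have Mc: "M \<subseteq> A" "A \<subseteq> carrier R"
    using ideal.Icarr[OF M(1)] subringE(1)[OF A] by auto
  have Madd: "x \<oplus> y \<in> M" if "x \<in> M" "y \<in> M" for x y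
    using additive_subgroup.a_closed[OF ideal.axioms(1)[OF M(1)]] that by simp
  have Mmult: "a \<otimes> x \<in> M" if "a \<in> A" "x \<in> M" for a x
    using ideal.I_l_closed[OF M(1)] that by simp
  have Mzero: "\<zero> \<in> M"
    using additive_subgroup.zero_closed[OF ideal.axioms(1)[OF M(1)]] by simp
  have subC: "subring C R"
    using subfieldE(1)[OF C] subcring.axioms(1) by blast
  have "\<exists>c\<in>C. \<exists>x\<in>M. a = c \<oplus> x" if "a \<in> generate_ring R (C \<union> S)" for a
    using that
  proof (induction rule: generate_ring.induct)
    case one
    then show ?case
      using subringE(3)[OF subC] Mzero by force
  next
    case (incl h)
    then consider "h \<in> C" | "h \<in> S" by auto
    then show ?case
    proof cases
      case 1
      then have "h = h \<oplus> \<zero>"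
        using subringE(1)[OF subC] by auto
      then show ?thesis
        using 1 Mzero by blast
    next
      case 2
      then have "h = \<zero> \<oplus> h"
        using S by auto
      then show ?thesis
        using 2 M subringE(2)[OF subC] by blast
    qed
  next
    case (a_inv h)
    then obtain c x where cx: "c \<in> C" "x \<in> M" "h = c \<oplus> x" by blast
    have carr: "c \<in> carrier R" "x \<in> carrier R"
      using cx Mc subringE(1)[OF subC] by auto
    have "(\<ominus> \<one>) \<otimes> x \<in> M"
      using Mmult cx subringE(3,5)[OF A] by blast
    then have "\<ominus> x \<in> M"
      using carr by (simp add: l_minus)
    moreover have "\<ominus> h = \<ominus> c \<oplus> \<ominus> x"
      using carr cx minus_add by simp
    ultimately show ?case
      using subringE(5)[OF subC] cx by blast
  next
    case (eng_add g h)
    then obtain c x d y where cx: "c \<in> C" "x \<in> M" "g = c \<oplus> x" "d \<in> C" "y \<in> M" "h = d \<oplus> y" by blast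
    have carr: "c \<in> carrier R" "x \<in> carrier R" "d \<in> carrier R" "y \<in> carrier R"
      using cx Mc subringE(1)[OF subC] by auto
    have "g \<oplus> h = (c \<oplus> d) \<oplus> (x \<oplus> y)"
      unfolding cx using carr by (simp add: a_ac)
    then show ?case
      using subringE(7)[OF subC] Madd cx by blast
  next
    case (eng_mult g h)
    then obtain c x d y where cx: "c \<in> C" "x \<in> M" "g = c \<oplus> x" "d \<in> C" "y \<in> M" "h = d \<oplus> y" by blast
    have carr: "c \<in> carrier R" "x \<in> carrier R" "d \<in> carrier R" "y \<in> carrier R"
      using cx Mc subringE(1)[OF subC] by auto
    have "g \<otimes> h = (c \<otimes> d) \<oplus> (c \<otimes> y \<oplus> h \<otimes> x)"
      unfolding cx using carr by (simp add: l_distr r_distr m_ac a_ac)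
    moreover have "c \<otimes> y \<oplus> h \<otimes> x \<in> M"
      using Madd Mmult cx incl eng_mult(2) A_def by blast
    ultimately show ?case
      using subringE(6)[OF subC] cx by blast
  qed
  then show "rational_point R C A M"
    using A incl M(1) subfield_m_inv(1)[OF C] subringE(6)[OF subC]
    by (intro rational_point.intro field_axioms rational_point_axioms.intro) (auto simp: A_def)
  show "S \<subseteq> M"
    by (rule M(2))
qed

text \<open>
  If the coordinates of a chart lie in the maximal ideal of \<open>V\<close>, then an element of the coordinate
  ring with non-zero constant term is a unit of \<open>V\<close>, being a non-zero constant plus a non-unit. So \<open>V\<close>
  contains the inverses of all denominators.
\<close>

lemma (in discrete_valuation_subring) localization_generate_ring_subset:
  assumes C: "subfield C R" "C \<subseteq> V" and S: "S \<subseteq> V - V_units"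
  defines "A \<equiv> generate_ring R (C \<union> S)"
  defines "M \<equiv> Idl\<^bsub>R\<lparr>carrier := A\<rparr>\<^esub> S"
  shows "localization_at R A M \<subseteq> V" "\<one> \<notin> M"
proof -
  have Sc: "S \<subseteq> carrier R"
    using S V_carrier by auto
  interpret P: rational_point R C A M
    unfolding A_def M_def by (rule rational_point_generate_ring(1)[OF C(1) Sc])
  have CS: "C \<union> S \<subseteq> carrier R"
    using C S V_carrier by auto
  have AV: "A \<subseteq> V"
    unfolding A_def using generate_ring_min_subring1[OF CS subring] C(2) S by auto
  interpret A: cring "R\<lparr>carrier := A\<rparr>"
    by (rule subring_is_cring[OF P.A_subring])
  have N: "ideal ((V - V_units) \<inter> A) (R\<lparr>carrier := A\<rparr>)"
  proof (rule idealI[OF A.ring_axioms])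
    show "subgroup ((V - V_units) \<inter> A) (add_monoid (R\<lparr>carrier := A\<rparr>))"
    proof (rule A.add.subgroupI)
      show "(V - V_units) \<inter> A \<noteq> {}"
        using additive_subgroup.zero_closed[OF ideal.axioms(1)[OF nonunits_ideal]]
          subringE(2)[OF P.A_subring] by auto
    next
      fix a assume a: "a \<in> (V - V_units) \<inter> A"
      have "(\<ominus> \<one>) \<otimes> a \<in> V - V_units"
        using ideal.I_l_closed[OF nonunits_ideal, of a "\<ominus> \<one>"] a subringE(3,5)[OF subring] by simp
      then have "\<ominus> a \<in> V - V_units"
        using a V_carrier by (simp add: l_minus)
      moreover have "\<ominus>\<^bsub>R\<lparr>carrier := A\<rparr>\<^esub> a = \<ominus> a"
        using a subringE(5)[OF P.A_subring] P.A_carrier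
        by (intro A.minus_equality) (auto simp: l_neg)
      ultimately show "\<ominus>\<^bsub>R\<lparr>carrier := A\<rparr>\<^esub> a \<in> (V - V_units) \<inter> A"
        using a subringE(5)[OF P.A_subring] by auto
    next
      fix a b assume "a \<in> (V - V_units) \<inter> A" "b \<in> (V - V_units) \<inter> A"
      then show "a \<oplus>\<^bsub>R\<lparr>carrier := A\<rparr>\<^esub> b \<in> (V - V_units) \<inter> A"
        using additive_subgroup.a_closed[OF ideal.axioms(1)[OF nonunits_ideal], of a b]
          subringE(7)[OF P.A_subring] by auto
    qed auto
  next
    fix a x assume "a \<in> (V - V_units) \<inter> A" "x \<in> carrier (R\<lparr>carrier := A\<rparr>)"
    then show "x \<otimes>\<^bsub>R\<lparr>carrier := A\<rparr>\<^esub> a \<in> (V - V_units) \<inter> A"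
      "a \<otimes>\<^bsub>R\<lparr>carrier := A\<rparr>\<^esub> x \<in> (V - V_units) \<inter> A"
      using ideal.I_l_closed[OF nonunits_ideal, of a x] ideal.I_r_closed[OF nonunits_ideal, of a x]
        subringE(6)[OF P.A_subring] AV by auto
  qed
  have "S \<subseteq> A"
    unfolding A_def by (auto intro: generate_ring.incl)
  then have MN: "M \<subseteq> V - V_units"
    using A.genideal_minimal[OF N, of S] S unfolding M_def by auto
  then show "\<one> \<notin> M"
    using one_V_unit by auto
  have unit: "inv b \<in> V" if b: "b \<in> A" "b \<notin> M" for b
  proof (rule ccontr)
    assume "inv b \<notin> V"
    obtain c x where cx: "c \<in> C" "x \<in> M" "b = c \<oplus> x"
      using P.residue b(1) by blast
    have carr: "c \<in> carrier R" "x \<in> carrier R" "b \<in> carrier R"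
      using cx P.C_subset P.A_carrier P.M_subset b by auto
    have "c \<noteq> \<zero>"
      using cx b carr by auto
    then have c_unit: "c \<in> V_units"
      using subring_Units_iff[OF subring] P.C_inverse C(2) cx by auto
    have "b \<in> V - V_units"
      using \<open>inv b \<notin> V\<close> b AV subring_Units_iff[OF subring] by auto
    then have "b \<ominus> x \<in> V - V_units"
    proof -
      have "(\<ominus> \<one>) \<otimes> x \<in> V - V_units"
        using ideal.I_l_closed[OF nonunits_ideal, of x "\<ominus> \<one>"] cx MN subringE(3,5)[OF subring] by auto
      then have "\<ominus> x \<in> V - V_units"
        using carr by (simp add: l_minus)
      then show ?thesis
        using additive_subgroup.a_closed[OF ideal.axioms(1)[OF nonunits_ideal] \<open>b \<in> V - V_units\<close>]
        by (simp add: minus_eq)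
    qed
    moreover have "b \<ominus> x = c"
      unfolding cx(3) using carr by (simp add: minus_eq a_assoc r_neg)
    ultimately show False
      using c_unit by simp
  qed
  show "localization_at R A M \<subseteq> V"
    using AV unit subringE(6)[OF subring] by (auto simp: localization_at_def)
qed

section \<open>The function field in coordinates\<close>

lemma bivariate_ring_simps:
  "carrier bivariate_ring = UNIV" "x \<otimes>\<^bsub>bivariate_ring\<^esub> y = x * y" "x \<oplus>\<^bsub>bivariate_ring\<^esub> y = x + y"
  "\<one>\<^bsub>bivariate_ring\<^esub> = 1" "\<zero>\<^bsub>bivariate_ring\<^esub> = 0"
  by (simp_all add: bivariate_ring_def ring_of_type_algebra_def)

lemma cring_bivariate_ring: "cring bivariate_ring"
  unfolding bivariate_ring_def by (rule cring_from_type_algebra)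

lemma curve_ideal_ideal: "ideal (curve_ideal f) bivariate_ring"
  unfolding curve_ideal_def
  by (rule cring.cgenideal_ideal[OF cring_bivariate_ring]) (simp add: bivariate_ring_simps)

lemma curve_ideal_iff: "q \<in> curve_ideal f \<longleftrightarrow> [:- to_fract f, 0, 1:] dvd q"
  by (auto simp: curve_ideal_def cgenideal_def bivariate_ring_simps dvd_def mult.commute)

lemma residue_class_hom: "residue_class f \<in> ring_hom bivariate_ring (function_field f)"
  unfolding function_field_def residue_class_def[abs_def]
  by (rule ideal.rcos_ring_hom[OF curve_ideal_ideal])

lemma cring_function_field: "cring (function_field f)"
  unfolding function_field_def by (rule ideal.quotient_is_cring[OF curve_ideal_ideal cring_bivariate_ring])

lemma minus_bivariate_ring: "x \<ominus>\<^bsub>bivariate_ring\<^esub> y = x - y"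
proof -
  interpret cring bivariate_ring by (rule cring_bivariate_ring)
  have "\<ominus>\<^bsub>bivariate_ring\<^esub> y = - y"
    by (rule minus_equality) (simp_all add: bivariate_ring_simps)
  then show ?thesis
    by (simp add: a_minus_def bivariate_ring_simps)
qed

lemma residue_class_eq_iff:
  "residue_class f p = residue_class f q \<longleftrightarrow> [:- to_fract f, 0, 1:] dvd p - q"
  using ring.quotient_eq_iff_same_a_r_cos[OF cring.axioms(1)[OF cring_bivariate_ring] curve_ideal_ideal, of p q f]
  by (simp add: residue_class_def bivariate_ring_simps minus_bivariate_ring curve_ideal_iff)

text \<open>
  The class of \<open>r + s Y\<close>. Division with remainder by \<open>Y\<^sup>2 - f\<close> gives every element of the function field
  exactly one such representation, which makes its arithmetic computable in \<open>\<complex>(X)\<close>.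
\<close>

definition el :: "complex poly \<Rightarrow> complex poly fract \<Rightarrow> complex poly fract \<Rightarrow> ratfun" where
  "el f r s = residue_class f [:r, s:]"

lemma el_closed [simp]: "el f r s \<in> carrier (function_field f)"
  using ring_hom_closed[OF residue_class_hom] by (simp add: el_def bivariate_ring_simps)

lemma el_eq_iff: "el f r s = el f r' s' \<longleftrightarrow> r = r' \<and> s = s'"
proof
  assume "el f r s = el f r' s'"
  then have dvd: "[:- to_fract f, 0, 1:] dvd [:r - r', s - s':]"
    by (simp add: el_def residue_class_eq_iff)
  have "[:r - r', s - s':] = 0"
  proof (rule ccontr)
    assume "[:r - r', s - s':] \<noteq> 0"
    then have "Polynomial.degree [:- to_fract f, 0, 1:] \<le> Polynomial.degree [:r - r', s - s':]"
      using dvd_imp_degree_le[OF dvd] by simp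
    also have "\<dots> \<le> 1"
      by simp
    finally show False by simp
  qed
  then show "r = r' \<and> s = s'" by simp
qed simp

lemma carrier_function_field_cases:
  assumes "h \<in> carrier (function_field f)"
  obtains r s where "h = el f r s"
proof -
  obtain q where q: "h = residue_class f q"
    using assms unfolding function_field_def FactRing_def A_RCOSETS_def'
    by (auto simp: residue_class_def)
  define m where "m = [:- to_fract f, 0, 1:]"
  have "Polynomial.degree (q mod m) < 2"
    using degree_mod_less[of m q] by (auto simp: m_def)
  then have "q mod m = [:coeff (q mod m) 0, coeff (q mod m) 1:]"
    by (intro poly_eqI) (auto simp: coeff_pCons coeff_eq_0 split: nat.splits)
  moreover have "residue_class f q = residue_class f (q mod m)"
    unfolding residue_class_eq_iff m_def[symmetric] by (simp add: minus_mod_eq_mult_div)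
  ultimately have "h = el f (coeff (q mod m) 0) (coeff (q mod m) 1)"
    unfolding el_def q by metis
  then show ?thesis
    using that by blast
qed

lemma el_add: "el f r s \<oplus>\<^bsub>function_field f\<^esub> el f r' s' = el f (r + r') (s + s')"
  using ring_hom_add[OF residue_class_hom, of "[:r, s:]" "[:r', s':]" f]
  by (simp add: el_def bivariate_ring_simps)

lemma el_mult:
  "el f r s \<otimes>\<^bsub>function_field f\<^esub> el f r' s' = el f (r * r' + s * s' * to_fract f) (r * s' + s * r')"
proof -
  have "el f r s \<otimes>\<^bsub>function_field f\<^esub> el f r' s' = residue_class f ([:r, s:] * [:r', s':])"
    using ring_hom_mult[OF residue_class_hom, of "[:r, s:]" "[:r', s':]" f]
    by (simp add: el_def bivariate_ring_simps)
  also have "\<dots> = el f (r * r' + s * s' * to_fract f) (r * s' + s * r')"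
    unfolding el_def residue_class_eq_iff
    by (rule dvdI[of _ _ "[:s * s':]"]) (simp add: algebra_simps)
  finally show ?thesis .
qed

lemma el_one: "\<one>\<^bsub>function_field f\<^esub> = el f 1 0"
  using ring_hom_one[OF residue_class_hom, of f]
  by (simp add: el_def bivariate_ring_simps one_pCons)

lemma el_zero: "\<zero>\<^bsub>function_field f\<^esub> = el f 0 0"
proof -
  interpret cring "function_field f" by (rule cring_function_field)
  have "el f 0 0 \<oplus>\<^bsub>function_field f\<^esub> el f 0 0 = el f 0 0"
    by (simp add: el_add)
  then show ?thesis
    using add.r_cancel_one el_closed by metis
qed

lemma el_uminus: "\<ominus>\<^bsub>function_field f\<^esub> el f r s = el f (- r) (- s)"
proof -
  interpret cring "function_field f" by (rule cring_function_field)
  show ?thesis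
    by (rule minus_equality) (simp_all add: el_add el_zero)
qed

lemma el_minus: "el f r s \<ominus>\<^bsub>function_field f\<^esub> el f r' s' = el f (r - r') (s - s')"
  by (simp add: a_minus_def el_uminus el_add)

lemma el_eq_zero_iff: "el f r s = \<zero>\<^bsub>function_field f\<^esub> \<longleftrightarrow> r = 0 \<and> s = 0"
  by (simp add: el_zero el_eq_iff)

lemma ratfun_const_el: "ratfun_const f c = el f (to_fract [:c:]) 0"
  by (simp add: ratfun_const_def el_def)

lemma ratfun_X_el: "ratfun_X f = el f (to_fract [:0, 1:]) 0"
  by (simp add: ratfun_X_def el_def)

lemma ratfun_Y_el: "ratfun_Y f = el f 0 1"
  by (simp add: ratfun_Y_def el_def)

lemma el_nat_pow: "el f r 0 [^]\<^bsub>function_field f\<^esub> (n::nat) = el f (r ^ n) 0"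
proof -
  interpret cring "function_field f" by (rule cring_function_field)
  show ?thesis
    by (induction n) (simp_all add: el_one el_mult mult.commute)
qed

lemma fract_as_quotient:
  fixes r :: "complex poly fract"
  obtains p q where "q \<noteq> 0" "r = to_fract p / to_fract q"
  by (metis Fract_conv_to_fract Fract_cases)

text \<open>
  For a polynomial of odd degree the norm \<open>r\<^sup>2 - s\<^sup>2 f\<close> has no non-trivial zero, since the two terms
  have degrees of different parity.
\<close>

lemma norm_nonzero_of_odd_degree:
  fixes r s :: "complex poly fract"
  assumes "odd (Polynomial.degree f)" "r \<noteq> 0 \<or> s \<noteq> 0"
  shows "r\<^sup>2 - s\<^sup>2 * to_fract f \<noteq> 0"
proof
  assume eq: "r\<^sup>2 - s\<^sup>2 * to_fract f = 0"
  have f: "f \<noteq> 0"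
    using assms(1) by auto
  have "s \<noteq> 0"
    using eq assms by auto
  obtain a b where ab: "b \<noteq> 0" "r = to_fract a / to_fract b"
    by (rule fract_as_quotient)
  obtain c d where cd: "d \<noteq> 0" "s = to_fract c / to_fract d"
    by (rule fract_as_quotient)
  have "to_fract ((a * d)\<^sup>2) = to_fract ((c * b)\<^sup>2 * f)"
    using eq ab cd by (simp add: field_simps power2_eq_square)
  then have sq: "(a * d)\<^sup>2 = (c * b)\<^sup>2 * f"
    by (simp only: to_fract_eq_iff)
  have nz: "c * b \<noteq> 0"
    using \<open>s \<noteq> 0\<close> cd ab by auto
  have "a * d \<noteq> 0"
    using sq nz f by auto
  then have "2 * Polynomial.degree (a * d) = 2 * Polynomial.degree (c * b) + Polynomial.degree f"
    using arg_cong[OF sq, of Polynomial.degree] nz f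
    by (simp add: degree_power_eq degree_mult_eq power2_eq_square)
  then show False
    using assms(1) by presburger
qed

locale odd_degree_curve =
  fixes f :: "complex poly"
  assumes odd_degree: "odd (Polynomial.degree f)"
begin

abbreviation "K \<equiv> function_field f"
abbreviation "F \<equiv> to_fract f"

lemma F_nonzero: "F \<noteq> 0"
  using odd_degree by auto

text \<open>Multiply by the conjugate \<open>r - s Y\<close> and divide by the norm.\<close>

lemma el_inverse_product:
  assumes "r \<noteq> 0 \<or> s \<noteq> 0"
  shows "el f r s \<otimes>\<^bsub>K\<^esub> el f (r / (r\<^sup>2 - s\<^sup>2 * F)) (- s / (r\<^sup>2 - s\<^sup>2 * F)) = \<one>\<^bsub>K\<^esub>"
proof -
  define N where "N = r\<^sup>2 - s\<^sup>2 * F"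
  have "N \<noteq> 0"
    using norm_nonzero_of_odd_degree[OF odd_degree assms] by (simp add: N_def)
  moreover have "r * (r / N) + s * (- s / N) * F = (r\<^sup>2 - s\<^sup>2 * F) / N"
    by (simp add: diff_divide_distrib power2_eq_square)
  ultimately show ?thesis
    using N_def by (simp add: el_mult el_one el_eq_iff)
qed

sublocale K: field K
proof -
  interpret cring K by (rule cring_function_field)
  show "field K"
  proof (rule cring_fieldI2)
    show "\<zero>\<^bsub>K\<^esub> \<noteq> \<one>\<^bsub>K\<^esub>"
      by (simp add: el_zero el_one el_eq_iff)
  next
    fix a assume "a \<in> carrier K" "a \<noteq> \<zero>\<^bsub>K\<^esub>"
    then obtain r s where "a = el f r s" "r \<noteq> 0 \<or> s \<noteq> 0"
      using carrier_function_field_cases el_eq_zero_iff by metis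
    then show "\<exists>b\<in>carrier K. a \<otimes>\<^bsub>K\<^esub> b = \<one>\<^bsub>K\<^esub>"
      using el_inverse_product el_closed by blast
  qed
qed

lemma el_inv:
  assumes "r \<noteq> 0 \<or> s \<noteq> 0"
  shows "inv\<^bsub>K\<^esub> el f r s = el f (r / (r\<^sup>2 - s\<^sup>2 * F)) (- s / (r\<^sup>2 - s\<^sup>2 * F))"
  using el_inverse_product[OF assms] by (intro K.inv_char) (auto simp: K.m_comm)

lemma el_inv_base: "r \<noteq> 0 \<Longrightarrow> inv\<^bsub>K\<^esub> el f r 0 = el f (1 / r) 0"
  by (simp add: el_inv power2_eq_square)

lemma el_inv_Y: "s \<noteq> 0 \<Longrightarrow> inv\<^bsub>K\<^esub> el f 0 s = el f 0 (1 / (s * F))"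
  using F_nonzero by (simp add: el_inv power2_eq_square)

lemma el_int_pow: "r \<noteq> 0 \<Longrightarrow> el f r 0 [^]\<^bsub>K\<^esub> (n::int) = el f (r powi n) 0"
  by (simp add: int_pow_def2 el_nat_pow el_inv_base power_int_def power_one_over inverse_eq_divide del: pow_nat)

lemma subfield_constants: "subfield (range (ratfun_const f)) K"
proof (rule K.subfieldI')
  show "subring (range (ratfun_const f)) K"
  proof (rule K.subringI)
    show "range (ratfun_const f) \<subseteq> carrier K"
      by (auto simp: ratfun_const_el)
    show "\<one>\<^bsub>K\<^esub> \<in> range (ratfun_const f)"
      by (rule range_eqI[of _ _ 1]) (simp add: ratfun_const_el el_one flip: one_pCons)
  next
    fix h assume "h \<in> range (ratfun_const f)"
    then obtain c where "h = ratfun_const f c" by auto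
    then show "\<ominus>\<^bsub>K\<^esub> h \<in> range (ratfun_const f)"
      by (intro range_eqI[of _ _ "- c"]) (simp add: ratfun_const_el el_uminus flip: to_fract_uminus)
  next
    fix g h assume "g \<in> range (ratfun_const f)" "h \<in> range (ratfun_const f)"
    then obtain c d where "g = ratfun_const f c" "h = ratfun_const f d" by auto
    then show "g \<otimes>\<^bsub>K\<^esub> h \<in> range (ratfun_const f)" "g \<oplus>\<^bsub>K\<^esub> h \<in> range (ratfun_const f)"
      by (auto intro!: range_eqI[of _ _ "c * d"] range_eqI[of _ _ "c + d"]
          simp: ratfun_const_el el_mult el_add simp flip: to_fract_mult to_fract_add)
  qed
next
  fix k assume "k \<in> range (ratfun_const f) - {\<zero>\<^bsub>K\<^esub>}"
  then obtain c where k: "k = ratfun_const f c" and "k \<noteq> \<zero>\<^bsub>K\<^esub>"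
    by blast
  then have c: "k = ratfun_const f c" "c \<noteq> 0"
    by (auto simp: ratfun_const_el el_eq_zero_iff)
  have "[:c:] * [:1 / c:] = 1"
    using c(2) by (simp add: one_pCons)
  then have "to_fract [:c:] * to_fract [:1 / c:] = 1"
    by (metis to_fract_1 to_fract_mult)
  then have "to_fract [:1 / c:] = 1 / to_fract [:c:]"
    using c(2) by (simp add: eq_divide_eq mult.commute)
  then have "inv\<^bsub>K\<^esub> k = ratfun_const f (1 / c)"
    using c by (simp add: ratfun_const_el el_inv_base)
  then show "inv\<^bsub>K\<^esub> k \<in> range (ratfun_const f)"
    by simp
qed

end

section \<open>Places of the rational function field\<close>

text \<open>The value \<open>P(z)\<close> in \<open>\<complex>(X)\<close> of a polynomial with constant coefficients.\<close>

definition peval :: "complex poly fract \<Rightarrow> complex poly \<Rightarrow> complex poly fract" where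
  "peval z P = poly (map_poly (\<lambda>c. to_fract [:c:]) P) z"

lemma peval_0 [simp]: "peval z 0 = 0"
  by (simp add: peval_def)

lemma peval_pCons [simp]: "peval z (pCons c P) = to_fract [:c:] + z * peval z P"
  by (simp add: peval_def map_poly_pCons)

lemma peval_1 [simp]: "peval z 1 = 1"
  by (simp only: one_pCons peval_pCons peval_0) (simp flip: one_pCons)

lemma peval_add [simp]: "peval z (P + Q) = peval z P + peval z Q"
  by (induction P Q rule: poly_induct2) (simp_all add: algebra_simps flip: to_fract_add)

lemma peval_smult [simp]: "peval z (Polynomial.smult c P) = to_fract [:c:] * peval z P"
  by (induction P) (simp_all add: algebra_simps flip: to_fract_mult)

lemma peval_mult [simp]: "peval z (P * Q) = peval z P * peval z Q"
  by (induction P) (simp_all add: algebra_simps)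

lemma peval_uminus [simp]: "peval z (- P) = - peval z P"
  by (induction P) (simp_all add: algebra_simps flip: to_fract_uminus)

lemma peval_power [simp]: "peval z (P ^ n) = peval z P ^ n"
  by (induction n) simp_all

lemma peval_to_fract: "peval (to_fract q) P = to_fract (P \<circ>\<^sub>p q)"
  by (induction P) (simp_all add: pcompose_pCons)

lemma poly_split_root:
  fixes P :: "complex poly"
  obtains P' where "P = [:poly P 0:] + [:0, 1:] * P'"
  by (cases P rule: pCons_cases) auto

text \<open>
  A local parameter \<open>z\<close> at a point of the projective line, that is, \<open>X - c\<close> or \<open>1/X\<close>: every rational
  function is a power of \<open>z\<close> times a fraction of polynomials in \<open>z\<close> with non-zero constant term.
\<close>

locale place =
  fixes z :: "complex poly fract"
  assumes transcendental: "peval z P = 0 \<Longrightarrow> P = 0"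
    and power_times_unit: "r \<noteq> 0 \<Longrightarrow>
      \<exists>n P Q. poly P 0 \<noteq> 0 \<and> poly Q 0 \<noteq> 0 \<and> r = z powi n * (peval z P / peval z Q)"
begin

definition "regular = {peval z P / peval z Q | P Q. poly Q 0 \<noteq> 0}"

definition "units = {peval z P / peval z Q | P Q. poly P 0 \<noteq> 0 \<and> poly Q 0 \<noteq> 0}"

lemma z_nonzero: "z \<noteq> 0"
  using transcendental[of "[:0, 1:]"] by (auto simp flip: one_pCons)

lemma peval_nonzero: "poly P 0 \<noteq> 0 \<Longrightarrow> peval z P \<noteq> 0"
  using transcendental by fastforce

lemma regularI: "poly Q 0 \<noteq> 0 \<Longrightarrow> peval z P / peval z Q \<in> regular"
  by (auto simp: regular_def)

lemma unitsI: "poly P 0 \<noteq> 0 \<Longrightarrow> poly Q 0 \<noteq> 0 \<Longrightarrow> peval z P / peval z Q \<in> units"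
  by (auto simp: units_def)

lemma regularE:
  assumes "r \<in> regular"
  obtains P Q where "poly Q 0 \<noteq> 0" "r = peval z P / peval z Q"
  using assms unfolding regular_def by blast

lemma unitsE:
  assumes "r \<in> units"
  obtains P Q where "poly P 0 \<noteq> 0" "poly Q 0 \<noteq> 0" "r = peval z P / peval z Q"
  using assms unfolding units_def by blast

lemma peval_regular: "peval z P \<in> regular"
  using regularI[of 1 P] by simp

lemma peval_units: "poly P 0 \<noteq> 0 \<Longrightarrow> peval z P \<in> units"
  using unitsI[of P 1] by simp

lemma const_regular: "to_fract [:c:] \<in> regular"
  using peval_regular[of "[:c:]"] by simp

lemma const_units: "c \<noteq> 0 \<Longrightarrow> to_fract [:c:] \<in> units"
  using peval_units[of "[:c:]"] by simp

lemma one_units: "1 \<in> units" and one_regular: "1 \<in> regular" and zero_regular: "0 \<in> regular"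
  and z_regular: "z \<in> regular"
  using peval_units[of 1] peval_regular[of 1] peval_regular[of 0] peval_regular[of "[:0, 1:]"]
  by (simp_all flip: one_pCons)

lemma two_units: "2 \<in> units"
proof -
  have "to_fract [:2::complex:] = 1 + 1"
    by (simp flip: to_fract_1 to_fract_add add: one_pCons)
  then show ?thesis
    using const_units[of 2] by simp
qed

lemma units_regular: "r \<in> units \<Longrightarrow> r \<in> regular"
  by (auto simp: units_def regular_def)

lemma units_nonzero: "r \<in> units \<Longrightarrow> r \<noteq> 0"
  using peval_nonzero by (auto simp: units_def)

lemma regular_mult: "r \<in> regular \<Longrightarrow> s \<in> regular \<Longrightarrow> r * s \<in> regular"
proof -
  assume "r \<in> regular" "s \<in> regular"
  then obtain P Q P' Q' where "poly Q 0 \<noteq> 0" "poly Q' 0 \<noteq> 0" "r = peval z P / peval z Q" "s = peval z P' / peval z Q'"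
    by (auto simp: regular_def)
  then show ?thesis
    using regularI[of "Q * Q'" "P * P'"] by simp
qed

lemma regular_add: "r \<in> regular \<Longrightarrow> s \<in> regular \<Longrightarrow> r + s \<in> regular"
proof -
  assume "r \<in> regular" "s \<in> regular"
  then obtain P Q P' Q' where PQ: "poly Q 0 \<noteq> 0" "poly Q' 0 \<noteq> 0" "r = peval z P / peval z Q" "s = peval z P' / peval z Q'"
    by (auto simp: regular_def)
  then have "r + s = peval z (P * Q' + P' * Q) / peval z (Q * Q')"
    using peval_nonzero by (simp add: add_frac_eq)
  then show ?thesis
    using regularI[of "Q * Q'" "P * Q' + P' * Q"] PQ(1,2) by (simp only: poly_mult) simp
qed

lemma regular_uminus: "r \<in> regular \<Longrightarrow> - r \<in> regular"
proof -
  have "to_fract [:- 1 :: complex:] = - 1"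
    by (metis minus_pCons minus_zero one_pCons to_fract_1 to_fract_uminus)
  then show "r \<in> regular \<Longrightarrow> - r \<in> regular"
    using regular_mult[OF const_regular[of "- 1"], of r] by simp
qed

lemma regular_diff: "r \<in> regular \<Longrightarrow> s \<in> regular \<Longrightarrow> r - s \<in> regular"
  using regular_add[OF _ regular_uminus, of r s] by simp

lemma regular_power: "r \<in> regular \<Longrightarrow> r ^ n \<in> regular"
  by (induction n) (auto intro: one_regular regular_mult)

lemma units_mult: "r \<in> units \<Longrightarrow> s \<in> units \<Longrightarrow> r * s \<in> units"
proof -
  assume "r \<in> units" "s \<in> units"
  then obtain P Q P' Q' where "poly P 0 \<noteq> 0" "poly P' 0 \<noteq> 0" "poly Q 0 \<noteq> 0" "poly Q' 0 \<noteq> 0"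
      "r = peval z P / peval z Q" "s = peval z P' / peval z Q'"
    by (auto simp: units_def)
  then show ?thesis
    using unitsI[of "P * P'" "Q * Q'"] by simp
qed

lemma units_inverse: "r \<in> units \<Longrightarrow> 1 / r \<in> units"
  by (erule unitsE) (use unitsI in simp)

lemma units_power_int: "r \<in> units \<Longrightarrow> r powi n \<in> units"
proof -
  assume r: "r \<in> units"
  have "r ^ k \<in> units" for k :: nat
    by (induction k) (auto intro: one_units units_mult r)
  then show ?thesis
    using units_inverse[of "r ^ nat (- n)"]
    by (auto simp: power_int_def power_one_over inverse_eq_divide)
qed

lemma units_add_multiple:
  assumes "r \<in> units" "s \<in> regular"
  shows "r + z * s \<in> units"
proof -
  obtain P Q P' Q' where PQ: "poly P 0 \<noteq> 0" "poly Q 0 \<noteq> 0" "poly Q' 0 \<noteq> 0"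
      "r = peval z P / peval z Q" "s = peval z P' / peval z Q'"
    using assms by (auto simp: units_def regular_def)
  then have "r + z * s = peval z (P * Q' + [:0, 1:] * P' * Q) / peval z (Q * Q')"
    using peval_nonzero by (simp add: add_frac_eq flip: one_pCons)
  then show ?thesis
    using unitsI[of "P * Q' + [:0, 1:] * P' * Q" "Q * Q'"] PQ by simp
qed

lemma inverse_z_not_regular: "r \<in> units \<Longrightarrow> r / z \<notin> regular"
proof
  assume "r \<in> units" "r / z \<in> regular"
  then obtain P Q P' Q' where PQ: "poly P 0 \<noteq> 0" "poly Q 0 \<noteq> 0" "poly Q' 0 \<noteq> 0"
      "r = peval z P / peval z Q" "r / z = peval z P' / peval z Q'"
    by (meson unitsE regularE)
  have "r = z * (peval z P' / peval z Q')"
    using PQ(5) z_nonzero by (simp add: field_simps)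
  then have "peval z P * peval z Q' = z * peval z P' * peval z Q"
    unfolding PQ(4) using PQ peval_nonzero by (simp add: field_simps)
  then have "peval z (P * Q' - [:0, 1:] * P' * Q) = 0"
    by (simp add: diff_conv_add_uminus del: add_uminus_conv_diff flip: one_pCons)
  then have "P * Q' = [:0, 1:] * P' * Q"
    using transcendental by fastforce
  then have "poly (P * Q') 0 = poly ([:0, 1:] * P' * Q) 0"
    by (simp only:)
  then show False
    using PQ by simp
qed

lemma exponent_and_unit:
  assumes "r \<noteq> 0"
  obtains n u where "u \<in> units" "r = z powi n * u"
  using power_times_unit[OF assms] unitsI by blast

text \<open>
  A function that is not regular is a negative power of \<open>z\<close> times a unit. This makes \<open>regular\<close> a
  valuation ring: of two functions, one divides the other.
\<close>

lemma regular_or_inverse: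
  assumes "r \<noteq> 0" "r \<notin> regular"
  obtains s where "s \<in> regular" "1 / r = z * s"
proof -
  obtain n u where nu: "u \<in> units" "r = z powi n * u"
    using exponent_and_unit[OF assms(1)] .
  have "n < 0"
  proof (rule ccontr)
    assume "\<not> n < 0"
    then have "z powi n \<in> regular"
      using regular_power[OF z_regular, of "nat n"] by (simp add: power_int_def)
    then show False
      using nu assms regular_mult units_regular by auto
  qed
  have "1 / r = z * (z ^ nat (- n - 1) * (1 / u))"
  proof -
    have "Suc (nat (- n - 1)) = nat (- n)"
      using \<open>n < 0\<close> by simp
    then have "z * z ^ nat (- n - 1) = z ^ nat (- n)"
      by (metis power_Suc)
    then show ?thesis
      unfolding nu(2) using \<open>n < 0\<close> by (simp add: power_int_def field_simps)
  qed
  moreover have "z ^ nat (- n - 1) * (1 / u) \<in> regular"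
    using nu(1) by (intro regular_mult regular_power z_regular units_regular units_inverse)
  ultimately show ?thesis
    using that by blast
qed

end

lemma polynomial_power_times_unit:
  fixes P :: "complex poly"
  assumes "P \<noteq> 0"
  obtains n P' where "P = [:0, 1:] ^ n * P'" "poly P' 0 \<noteq> 0"
  using order_decomp[OF assms, of 0] that by (auto simp: poly_eq_0_iff_dvd)

lemma place_I:
  assumes transcendental: "\<And>P. poly P 0 \<noteq> 0 \<Longrightarrow> peval z P \<noteq> 0" and "z \<noteq> 0"
    and polynomials: "\<And>p. p \<noteq> 0 \<Longrightarrow> \<exists>n P. poly P 0 \<noteq> 0 \<and> to_fract p = z powi n * peval z P"
  shows "place z"
proof
  fix P assume "peval z P = 0"
  show "P = 0"
  proof (rule ccontr)
    assume "P \<noteq> 0"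
    then obtain n P' where "P = [:0, 1:] ^ n * P'" "poly P' 0 \<noteq> 0"
      by (rule polynomial_power_times_unit)
    then show False
      using transcendental[of P'] \<open>z \<noteq> 0\<close> \<open>peval z P = 0\<close> by (simp flip: one_pCons)
  qed
next
  fix r :: "complex poly fract" assume "r \<noteq> 0"
  obtain a b where ab: "b \<noteq> 0" "r = to_fract a / to_fract b"
    by (rule fract_as_quotient)
  then have "a \<noteq> 0"
    using \<open>r \<noteq> 0\<close> by auto
  obtain n P where P: "poly P 0 \<noteq> 0" "to_fract a = z powi n * peval z P"
    using polynomials[OF \<open>a \<noteq> 0\<close>] by blast
  obtain m Q where Q: "poly Q 0 \<noteq> 0" "to_fract b = z powi m * peval z Q"
    using polynomials[OF ab(1)] by blast
  have "r = z powi (n - m) * (peval z P / peval z Q)"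
    unfolding ab(2) P(2) Q(2) using \<open>z \<noteq> 0\<close> by (simp add: power_int_diff)
  then show "\<exists>n P Q. poly P 0 \<noteq> 0 \<and> poly Q 0 \<noteq> 0 \<and> r = z powi n * (peval z P / peval z Q)"
    using P Q by blast
qed

text \<open>Taylor expansion at \<open>c\<close>.\<close>

lemma to_fract_eq_peval_finite: "to_fract p = peval (to_fract [:- c, 1:]) (p \<circ>\<^sub>p [:c, 1:])"
proof -
  have "[:c, 1:] \<circ>\<^sub>p [:- c, 1:] = [:0, 1:]"
    by (simp add: pcompose_pCons)
  then show ?thesis
    by (simp add: peval_to_fract flip: pcompose_assoc)
qed

lemma place_finite: "place (to_fract [:- c, 1:])"
proof (rule place_I)
  fix P :: "complex poly" assume "poly P 0 \<noteq> 0"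
  then have "poly (P \<circ>\<^sub>p [:- c, 1:]) c \<noteq> 0"
    by (simp add: poly_pcompose)
  then show "peval (to_fract [:- c, 1:]) P \<noteq> 0"
    unfolding peval_to_fract by auto
next
  fix p :: "complex poly" assume "p \<noteq> 0"
  then have "p \<circ>\<^sub>p [:c, 1:] \<noteq> 0"
    by (simp add: pcompose_eq_0_iff)
  then obtain n P where P: "p \<circ>\<^sub>p [:c, 1:] = [:0, 1:] ^ n * P" "poly P 0 \<noteq> 0"
    by (rule polynomial_power_times_unit)
  then have "to_fract p = to_fract [:- c, 1:] powi int n * peval (to_fract [:- c, 1:]) P"
    unfolding to_fract_eq_peval_finite[of p c] by (simp flip: one_pCons)
  then show "\<exists>n P. poly P 0 \<noteq> 0 \<and> to_fract p = to_fract [:- c, 1:] powi n * peval (to_fract [:- c, 1:]) P"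
    using P by blast
qed simp

text \<open>In terms of \<open>1/X\<close>, a polynomial is its reversed polynomial up to a power of \<open>X\<close>.\<close>

lemma to_fract_eq_peval_infinity:
  "to_fract p = to_fract [:0, 1:] ^ Polynomial.degree p * peval (1 / to_fract [:0, 1:]) (reflect_poly p)"
proof -
  let ?k = "\<lambda>c::complex. to_fract [:c:]"
  have deg: "Polynomial.degree (map_poly ?k p) = Polynomial.degree p"
    by (simp add: degree_map_poly)
  have "map_poly ?k (reflect_poly p) = reflect_poly (map_poly ?k p)"
    by (rule poly_eqI) (simp add: coeff_map_poly coeff_reflect_poly deg)
  then have "peval (1 / to_fract [:0, 1:]) (reflect_poly p)
      = (1 / to_fract [:0, 1:]) ^ Polynomial.degree p * peval (to_fract [:0, 1:]) p"
    unfolding peval_def by (simp add: poly_reflect_poly_nz deg inverse_eq_divide)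
  moreover have "peval (to_fract [:0, 1:]) p = to_fract p"
    by (simp add: peval_to_fract)
  ultimately show ?thesis
    by (simp add: power_one_over)
qed

lemma place_infinity: "place (1 / to_fract [:0, 1:])"
proof (rule place_I)
  fix P :: "complex poly" assume P: "poly P 0 \<noteq> 0"
  then have "P = reflect_poly (reflect_poly P)"
    by (simp add: poly_0_coeff_0)
  then show "peval (1 / to_fract [:0, 1:]) P \<noteq> 0"
    using to_fract_eq_peval_infinity[of "reflect_poly P"] P by auto
next
  fix p :: "complex poly" assume "p \<noteq> 0"
  moreover have "to_fract p = (1 / to_fract [:0, 1:]) powi (- int (Polynomial.degree p))
      * peval (1 / to_fract [:0, 1:]) (reflect_poly p)"
    by (subst to_fract_eq_peval_infinity)
      (simp add: power_int_minus power_one_over inverse_eq_divide)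
  ultimately show "\<exists>n P. poly P 0 \<noteq> 0 \<and>
      to_fract p = (1 / to_fract [:0, 1:]) powi n * peval (1 / to_fract [:0, 1:]) P"
    by (metis poly_reflect_poly_0 leading_coeff_0_iff)
qed simp

section \<open>Integral closures of the local rings of the plane curve\<close>

lemma integral_closure_of_degree_1:
  assumes "cring K" "subring A K" "h \<in> A"
  shows "h \<in> integral_closure_in K A"
proof -
  interpret K: cring K by fact
  have h: "h \<in> carrier K" "\<ominus>\<^bsub>K\<^esub> h \<in> A" "\<ominus>\<^bsub>K\<^esub> h \<in> carrier K"
    using assms subringE(1,5)[OF assms(2)] by auto
  have "(\<Oplus>\<^bsub>K\<^esub>j\<in>{..<1::nat}. \<ominus>\<^bsub>K\<^esub> h \<otimes>\<^bsub>K\<^esub> h [^]\<^bsub>K\<^esub> j) = \<ominus>\<^bsub>K\<^esub> h"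
    using h K.finsum_insert[of "{}" "0::nat" "\<lambda>j. \<ominus>\<^bsub>K\<^esub> h \<otimes>\<^bsub>K\<^esub> h [^]\<^bsub>K\<^esub> j"]
    by (simp add: lessThan_Suc)
  then have "h [^]\<^bsub>K\<^esub> (1::nat) \<oplus>\<^bsub>K\<^esub> (\<Oplus>\<^bsub>K\<^esub>j\<in>{..<1::nat}. \<ominus>\<^bsub>K\<^esub> h \<otimes>\<^bsub>K\<^esub> h [^]\<^bsub>K\<^esub> j) = \<zero>\<^bsub>K\<^esub>"
    using h by (simp add: K.r_neg)
  then show ?thesis
    unfolding integral_closure_in_def using h
    by (intro CollectI conjI exI[of _ "1::nat"] exI[of _ "\<lambda>j. \<ominus>\<^bsub>K\<^esub> h"]) auto
qed

lemma integral_closure_of_degree_2: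
  assumes "cring K" "A \<subseteq> carrier K" "h \<in> carrier K" "c \<in> A" "d \<in> A"
    and eq: "h \<otimes>\<^bsub>K\<^esub> h \<oplus>\<^bsub>K\<^esub> (d \<otimes>\<^bsub>K\<^esub> h \<oplus>\<^bsub>K\<^esub> c) = \<zero>\<^bsub>K\<^esub>"
  shows "h \<in> integral_closure_in K A"
proof -
  interpret K: cring K by fact
  define g where "g j = (if j = 0 then c else d)" for j :: nat
  have g: "g \<in> {..<2} \<rightarrow> A"
    using assms by (auto simp: g_def)
  have "(\<Oplus>\<^bsub>K\<^esub>j\<in>{..<2::nat}. g j \<otimes>\<^bsub>K\<^esub> h [^]\<^bsub>K\<^esub> j) = d \<otimes>\<^bsub>K\<^esub> h \<oplus>\<^bsub>K\<^esub> c"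
  proof -
    have "{..<2::nat} = insert 1 (insert 0 {})" by auto
    then show ?thesis
      using assms(2-5) by (simp add: g_def subsetD)
  qed
  then have "h [^]\<^bsub>K\<^esub> (2::nat) \<oplus>\<^bsub>K\<^esub> (\<Oplus>\<^bsub>K\<^esub>j\<in>{..<2::nat}. g j \<otimes>\<^bsub>K\<^esub> h [^]\<^bsub>K\<^esub> j) = \<zero>\<^bsub>K\<^esub>"
    using eq assms(3) by (simp add: numeral_2_eq_2)
  then show ?thesis
    unfolding integral_closure_in_def using g assms(3) by blast
qed

lemma integral_closure_of_empty: 
  assumes "field K"
  shows "integral_closure_in K {} = {}"
proof -
  interpret field K by fact
  have False if h: "h [^]\<^bsub>K\<^esub> n \<oplus>\<^bsub>K\<^esub> (\<Oplus>\<^bsub>K\<^esub>j\<in>{..<n}. c j \<otimes>\<^bsub>K\<^esub> h [^]\<^bsub>K\<^esub> j) = \<zero>\<^bsub>K\<^esub>"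
    and c: "c \<in> {..<n} \<rightarrow> {}" for h c and n :: nat
  proof (cases n)
    case 0
    then show ?thesis using h by simp
  next
    case (Suc m)
    then show ?thesis using c by auto
  qed
  then show ?thesis
    unfolding integral_closure_in_def by blast
qed

locale curve_at_place = odd_degree_curve f + place z for f z
begin

abbreviation "constants \<equiv> range (ratfun_const f)"

lemma peval_in_subring:
  assumes "subring A K" "constants \<subseteq> A" "el f z 0 \<in> A"
  shows "el f (peval z P) 0 \<in> A"
proof (induction P)
  case 0
  then show ?case
    using subringE(2)[OF assms(1)] by (simp add: el_zero)
next
  case (pCons c P)
  have "el f (peval z (pCons c P)) 0 = ratfun_const f c \<oplus>\<^bsub>K\<^esub> el f z 0 \<otimes>\<^bsub>K\<^esub> el f (peval z P) 0"
    by (simp add: ratfun_const_el el_mult el_add)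
  moreover have "ratfun_const f c \<in> A"
    using assms(2) by blast
  ultimately show ?case
    using subringE(6,7)[OF assms(1)] assms(3) pCons by simp
qed

text \<open>
  A polynomial in \<open>z\<close> agrees with its constant term modulo an ideal containing \<open>z\<close>; so
  denominators that are regular at the place are units of the local ring.
\<close>

lemma peval_notin_ideal:
  assumes P: "proper_rational_point K constants A M" "el f z 0 \<in> M" and "poly P 0 \<noteq> 0"
  shows "el f (peval z P) 0 \<in> A - M"
proof -
  interpret P: proper_rational_point K constants A M by fact
  have in_A: "el f (peval z Q) 0 \<in> A" for Q
    using peval_in_subring[OF P.A_subring P.C_subset] P.M_subset P(2) by simp
  obtain P' where P': "P = [:poly P 0:] + [:0, 1:] * P'"
    by (rule poly_split_root)
  have "peval z P = to_fract [:poly P 0:] + z * peval z P'"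
    by (subst P') (simp flip: one_pCons)
  then have diff: "ratfun_const f (poly P 0) = el f (peval z P) 0 \<ominus>\<^bsub>K\<^esub> el f (peval z P') 0 \<otimes>\<^bsub>K\<^esub> el f z 0"
    by (simp add: ratfun_const_el el_mult el_minus)
  have "ratfun_const f (poly P 0) \<in> M" if "el f (peval z P) 0 \<in> M"
    unfolding diff using that P.M_mult[OF in_A P(2)] by (rule P.M_diff)
  moreover have "ratfun_const f (poly P 0) \<noteq> \<zero>\<^bsub>K\<^esub>"
    using assms(3) by (simp add: ratfun_const_el el_eq_zero_iff)
  ultimately show ?thesis
    using P.C_M_zero in_A by blast
qed

lemma regular_in_local_ring:
  assumes P: "proper_rational_point K constants A M" "el f z 0 \<in> M" and "r \<in> regular"
  shows "el f r 0 \<in> localization_at K A M"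
proof -
  interpret P: proper_rational_point K constants A M by fact
  obtain p q where pq: "poly q 0 \<noteq> 0" "r = peval z p / peval z q"
    using assms(3) by (rule regularE)
  have "el f r 0 = el f (peval z p) 0 \<otimes>\<^bsub>K\<^esub> inv\<^bsub>K\<^esub> el f (peval z q) 0"
    using pq peval_nonzero by (simp add: el_inv_base el_mult)
  moreover have "el f (peval z p) 0 \<in> A"
    using peval_in_subring[OF P.A_subring P.C_subset] P.M_subset P(2) by simp
  ultimately show ?thesis
    using localization_atI[of _ A _ M K] peval_notin_ideal[OF P pq(1)] by simp
qed

lemma units_in_subring:
  assumes "subring L K" "\<And>r. r \<in> regular \<Longrightarrow> el f r 0 \<in> L" "r \<in> units"
  shows "el f r 0 \<in> Units (K\<lparr>carrier := L\<rparr>)"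
  using assms K.subring_Units_iff[OF assms(1)] units_nonzero[of r] units_inverse[of r] units_regular
  by (simp add: el_inv_base el_eq_zero_iff)

text \<open>
  At a point where \<open>Y\<close> does not vanish the plane curve is smooth with local parameter \<open>z\<close>. If
  \<open>h = 1 + s Y\<close> or \<open>h = r + Y\<close> vanishes there, then its conjugate does not, since \<open>h\<close> plus (or minus)
  its conjugate is \<open>2\<close> (or \<open>2 Y\<close>); so \<open>h\<close> is its norm divided by a unit, and the norm, a function of \<open>X\<close>
  alone, is a power of \<open>z\<close> times a unit.
\<close>

lemma unramified_valuation_ring:
  assumes P: "proper_rational_point K constants A M" and z: "el f z 0 \<in> M" and Y: "el f 0 1 \<in> A - M"
  shows "discrete_valuation_subring K (localization_at K A M) (el f z 0)"
proof -
  interpret P: proper_rational_point K constants A M by fact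
  have reg: "\<And>r. r \<in> regular \<Longrightarrow> el f r 0 \<in> P.L"
    using regular_in_local_ring[OF P z] .
  have unit: "el f r 0 \<in> Units (K\<lparr>carrier := P.L\<rparr>)" if "r \<in> units" for r
    by (rule units_in_subring[OF P.L_subring _ that]) (rule reg)
  let ?U = "Units (K\<lparr>carrier := P.L\<rparr>)"
  have z_nz: "el f z 0 \<in> carrier K - {\<zero>\<^bsub>K\<^esub>}"
    using z_nonzero by (simp add: el_eq_zero_iff)
  note U = K.subring_Units_carrier[OF P.L_subring]
  note Umult = K.subring_Units_mult[OF P.L_subring]
  define good where "good = K.unit_times_power P.L (el f z 0)"
  note good_unit = K.unit_times_power_unit[OF P.L_subring, of _ "el f z 0", folded good_def]
  note good_mult = K.unit_times_power_mult[OF P.L_subring z_nz, folded good_def]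
  have good_base: "good (el f r 0)" if r: "r \<noteq> 0" for r
  proof -
    obtain n u where "u \<in> units" "r = z powi n * u"
      using exponent_and_unit[OF r] .
    then have "el f r 0 = el f u 0 \<otimes>\<^bsub>K\<^esub> el f z 0 [^]\<^bsub>K\<^esub> n" "el f u 0 \<in> ?U"
      using z_nonzero unit by (auto simp: el_int_pow el_mult mult.commute)
    then show ?thesis
      unfolding good_def K.unit_times_power_def by blast
  qed
  have good_if_conjugate: "good h"
    if h: "h \<in> P.L" "h' \<in> P.L" "h \<oplus>\<^bsub>K\<^esub> h' \<in> ?U" "h \<otimes>\<^bsub>K\<^esub> h' = el f N 0" "h \<noteq> \<zero>\<^bsub>K\<^esub>" for h h' N
  proof (cases "h \<in> ?U")
    case True
    then show ?thesis by (rule good_unit)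
  next
    case False
    then have h': "h' \<in> ?U"
      using P.nonunits_L_add[of h h'] h by blast
    have hc: "h \<in> carrier K"
      using h subringE(1)[OF P.L_subring] by auto
    have "N \<noteq> 0"
      using h U(2)[OF h'] hc K.integral_iff[of h h'] by (auto simp: el_eq_zero_iff)
    have "h = el f N 0 \<otimes>\<^bsub>K\<^esub> inv\<^bsub>K\<^esub> h'"
      using U(2)[OF h'] K.nonzero_inv(1,2)[OF U(2)[OF h']] hc by (simp flip: h(4) add: K.m_assoc)
    then show ?thesis
      using good_mult[OF good_base[OF \<open>N \<noteq> 0\<close>] good_unit[OF U(3)[OF h']]] by simp
  qed
  have YL: "el f 0 1 \<in> ?U" "el f 0 1 \<in> P.L"
    using Y P.nonunit_L_A[of "el f 0 1"] P.A_subset_L by auto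
  \<comment> \<open>Extract \<open>r\<close> or \<open>s\<close> from \<open>r + s Y\<close>, whichever divides the other.\<close>
  have factor: "good h" if h: "h \<in> carrier K" "h \<noteq> \<zero>\<^bsub>K\<^esub>" for h
  proof -
    obtain r s where rs: "h = el f r s"
      using carrier_function_field_cases h(1) by blast
    show ?thesis
    proof (cases "r \<noteq> 0 \<and> s / r \<in> regular")
      case True
      define q where "q = s / r"
      have q: "q \<in> regular" "- q \<in> regular"
        using True regular_uminus by (auto simp: q_def)
      have mem: "el f 1 p \<in> P.L" if "p \<in> regular" for p
      proof -
        have "el f 1 0 \<oplus>\<^bsub>K\<^esub> el f p 0 \<otimes>\<^bsub>K\<^esub> el f 0 1 \<in> P.L"
          using reg[OF that] reg[OF one_regular] YL subringE(6,7)[OF P.L_subring] by simp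
        then show ?thesis
          by (simp add: el_mult el_add)
      qed
      have "el f 1 q \<oplus>\<^bsub>K\<^esub> el f 1 (- q) = el f 2 0"
        by (simp add: el_add)
      then have "good (el f 1 q)"
        using unit[OF two_units] q
        by (intro good_if_conjugate[of _ "el f 1 (- q)" "1 - q\<^sup>2 * F"] mem)
          (auto simp: el_mult el_eq_zero_iff power2_eq_square)
      moreover have "h = el f r 0 \<otimes>\<^bsub>K\<^esub> el f 1 q"
        using True by (simp add: rs q_def el_mult)
      ultimately show ?thesis
        using good_mult good_base True by simp
    next
      case False
      have "s \<noteq> 0"
        using False h(2) rs zero_regular by (auto simp: el_eq_zero_iff)
      have "r / s \<in> regular"
      proof (cases "r = 0")
        case False
        then obtain p where "p \<in> regular" "1 / (s / r) = z * p"
          using regular_or_inverse[of "s / r"] \<open>\<not> (r \<noteq> 0 \<and> s / r \<in> regular)\<close> \<open>s \<noteq> 0\<close> by auto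
        then show ?thesis
          using regular_mult[OF z_regular] by simp
      qed (simp add: zero_regular)
      define q where "q = r / s"
      have q: "q \<in> regular" "- q \<in> regular"
        using \<open>r / s \<in> regular\<close> regular_uminus by (auto simp: q_def)
      have mem: "el f p 1 \<in> P.L" if "p \<in> regular" for p
      proof -
        have "el f p 0 \<oplus>\<^bsub>K\<^esub> el f 0 1 \<in> P.L"
          using reg[OF that] YL subringE(7)[OF P.L_subring] by simp
        then show ?thesis
          by (simp add: el_add)
      qed
      have "el f q 1 \<oplus>\<^bsub>K\<^esub> el f (- q) 1 = el f 2 0 \<otimes>\<^bsub>K\<^esub> el f 0 1"
        by (simp add: el_add el_mult)
      then have "good (el f q 1)"
        using Umult[OF unit[OF two_units] YL(1)] q
        by (intro good_if_conjugate[of _ "el f (- q) 1" "F - q\<^sup>2"] mem)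
          (auto simp: el_mult el_eq_zero_iff power2_eq_square)
      moreover have "h = el f s 0 \<otimes>\<^bsub>K\<^esub> el f q 1"
        using \<open>s \<noteq> 0\<close> by (simp add: rs q_def el_mult)
      ultimately show ?thesis
        using good_mult good_base \<open>s \<noteq> 0\<close> by simp
    qed
  qed
  have "inv\<^bsub>K\<^esub> el f z 0 \<notin> P.L"
    using P.nonunit_L_A[of "el f z 0"] z P.M_subset P.A_subset_L
      K.subring_Units_iff[OF P.L_subring, of "el f z 0"] z_nz by auto
  then show ?thesis
    using P.L_subring z P.M_subset P.A_subset_L z_nz factor unfolding good_def
    by (intro discrete_valuation_subring.intro K.field_axioms discrete_valuation_subring_axioms.intro) auto
qed

end

text \<open>
  The branch points: \<open>f\<close> has odd order at the place. The exponent \<open>e\<close> is negative at infinity.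
\<close>

locale ramified_place = curve_at_place f z for f z +
  fixes \<epsilon> :: "complex poly fract" and e :: int
  assumes unit: "\<epsilon> \<in> units" and odd_order: "F = \<epsilon> * z powi (2 * e + 1)"
begin

text \<open>
  With \<open>W = w Y\<close>, where \<open>W\<^sup>2 = \<epsilon> z\<close>, the ring \<open>ramified_ring\<close> is \<open>regular + regular W\<close>.
\<close>

definition "w = z powi (- e)"

definition "ramified_ring = {el f r (s * w) | r s. r \<in> regular \<and> s \<in> regular}"

lemma w_nonzero: "w \<noteq> 0"
  using z_nonzero by (simp add: w_def)

lemma w_square: "w * w * F = \<epsilon> * z"
proof -
  have add: "z powi a * z powi b = z powi (a + b)" for a b
    using z_nonzero by (simp add: power_int_add)
  have "w * w * F = \<epsilon> * (z powi (- e) * z powi (- e) * z powi (2 * e + 1))"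
    unfolding w_def odd_order by (simp only: mult_ac)
  then show ?thesis
    unfolding add by simp
qed

lemma ramified_ringI: "r \<in> regular \<Longrightarrow> s \<in> regular \<Longrightarrow> el f r (s * w) \<in> ramified_ring"
  by (auto simp: ramified_ring_def)

lemma ramified_ring_iff: "el f r (s * w) \<in> ramified_ring \<longleftrightarrow> r \<in> regular \<and> s \<in> regular"
  using w_nonzero by (auto simp: ramified_ring_def el_eq_iff)

lemma ramified_ring_base: "r \<in> regular \<Longrightarrow> el f r 0 \<in> ramified_ring"
  using ramified_ringI[of r 0] zero_regular by simp

lemma el_mult_w:
  "el f r (s * w) \<otimes>\<^bsub>K\<^esub> el f r' (s' * w) = el f (r * r' + z * (s * s' * \<epsilon>)) ((r * s' + s * r') * w)"
proof -
  have "s * w * (s' * w) * F = s * s' * (w * w * F)"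
    by (simp only: mult_ac)
  also have "\<dots> = z * (s * s' * \<epsilon>)"
    unfolding w_square by (simp only: mult_ac)
  finally have norm: "s * w * (s' * w) * F = z * (s * s' * \<epsilon>)" .
  show ?thesis
    unfolding el_mult norm by (simp add: algebra_simps)
qed

lemma ramified_ring_subring: "subring ramified_ring K"
proof (rule K.subringI)
  show "ramified_ring \<subseteq> carrier K"
    by (auto simp: ramified_ring_def)
  show "\<one>\<^bsub>K\<^esub> \<in> ramified_ring"
    using ramified_ring_base[OF one_regular] by (simp add: el_one)
next
  fix h assume "h \<in> ramified_ring"
  then obtain r s where "h = el f r (s * w)" "r \<in> regular" "s \<in> regular"
    by (auto simp: ramified_ring_def)
  then show "\<ominus>\<^bsub>K\<^esub> h \<in> ramified_ring"
    using ramified_ringI[OF regular_uminus regular_uminus, of r s] by (simp add: el_uminus)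
next
  fix g h assume "g \<in> ramified_ring" "h \<in> ramified_ring"
  then obtain r s r' s' where gh: "g = el f r (s * w)" "r \<in> regular" "s \<in> regular"
      "h = el f r' (s' * w)" "r' \<in> regular" "s' \<in> regular"
    by (auto simp: ramified_ring_def)
  have "el f (r * r' + z * (s * s' * \<epsilon>)) ((r * s' + s * r') * w) \<in> ramified_ring"
    using gh by (intro ramified_ringI regular_add regular_mult z_regular units_regular[OF unit])
  then show "g \<otimes>\<^bsub>K\<^esub> h \<in> ramified_ring"
    by (simp add: gh el_mult_w)
  have "el f (r + r') ((s + s') * w) \<in> ramified_ring"
    using gh by (intro ramified_ringI regular_add)
  then show "g \<oplus>\<^bsub>K\<^esub> h \<in> ramified_ring"
    by (simp add: gh el_add algebra_simps)
qed

text \<open>Its norm \<open>1 - z s\<^sup>2 \<epsilon>\<close> is a unit, being \<open>1\<close> plus a multiple of \<open>z\<close>.\<close>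

lemma ramified_unit:
  assumes "s \<in> regular"
  shows "el f 1 (s * w) \<in> Units (K\<lparr>carrier := ramified_ring\<rparr>)"
proof -
  define N where "N = 1 + z * (- (s * s * \<epsilon>))"
  have N: "N \<in> units"
    unfolding N_def using assms
    by (intro units_add_multiple one_units regular_uminus regular_mult units_regular[OF unit])
  have "el f 1 (s * w) \<otimes>\<^bsub>K\<^esub> el f (1 / N) ((- s / N) * w) = \<one>\<^bsub>K\<^esub>"
  proof -
    have "1 * (1 / N) + z * (s * (- s / N) * \<epsilon>) = (1 + z * (- (s * s * \<epsilon>))) / N"
      by (simp add: diff_divide_distrib)
    then have "1 * (1 / N) + z * (s * (- s / N) * \<epsilon>) = N / N"
      by (simp only: N_def)
    then have "1 * (1 / N) + z * (s * (- s / N) * \<epsilon>) = 1"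
      using units_nonzero[OF N] by simp
    then show ?thesis
      unfolding el_mult_w el_one by (simp add: el_eq_iff)
  qed
  moreover have "el f (1 / N) ((- s / N) * w) \<in> ramified_ring"
    using units_regular[OF units_inverse[OF N]] regular_mult[OF regular_uminus[OF assms], of "1 / N"]
    by (intro ramified_ringI) auto
  moreover have "el f 1 (s * w) \<in> ramified_ring"
    by (intro ramified_ringI one_regular assms)
  ultimately show ?thesis
    using K.m_comm[OF el_closed el_closed, of 1 "s * w"] unfolding Units_def by fastforce
qed

lemma uniformizer_square: "el f 0 w \<otimes>\<^bsub>K\<^esub> el f 0 w = el f (\<epsilon> * z) 0"
  by (simp add: el_mult w_square)

lemma uniformizer_nonzero: "el f 0 w \<in> carrier K - {\<zero>\<^bsub>K\<^esub>}"
  using w_nonzero by (simp add: el_eq_zero_iff)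

lemma uniformizer_even_power: "el f 0 w [^]\<^bsub>K\<^esub> (2 * n :: int) = el f ((\<epsilon> * z) powi n) 0"
proof -
  have "el f 0 w [^]\<^bsub>K\<^esub> (2::int) = el f 0 w \<otimes>\<^bsub>K\<^esub> el f 0 w"
    using K.int_pow_add[OF uniformizer_nonzero, of 1 1] by (simp add: K.int_pow_one_exp)
  then have "el f 0 w [^]\<^bsub>K\<^esub> (2 * n) = el f (\<epsilon> * z) 0 [^]\<^bsub>K\<^esub> n"
    using K.int_pow_mult_pow[OF uniformizer_nonzero, of 2 n] by (simp add: uniformizer_square)
  then show ?thesis
    using units_nonzero[OF unit] z_nonzero by (simp add: el_int_pow)
qed

text \<open>
  Since \<open>w Y\<close> has square \<open>\<epsilon> z\<close>, it is a uniformizer: in \<open>r + s w Y\<close> the two terms have orders of different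
  parity, so that one of them dominates the other.
\<close>

lemma ramified_valuation_ring: "discrete_valuation_subring K ramified_ring (el f 0 w)"
proof -
  let ?U = "Units (K\<lparr>carrier := ramified_ring\<rparr>)"
  let ?t = "el f 0 w"
  have base_unit: "el f u 0 \<in> ?U" if "u \<in> units" for u
    by (rule units_in_subring[OF ramified_ring_subring _ that]) (rule ramified_ring_base)
  define good where "good = K.unit_times_power ramified_ring ?t"
  note good_unit = K.unit_times_power_unit[OF ramified_ring_subring, of _ ?t, folded good_def]
  note good_mult = K.unit_times_power_mult[OF ramified_ring_subring uniformizer_nonzero, folded good_def]
  note good_pow = K.unit_times_power_int_pow[OF ramified_ring_subring uniformizer_nonzero, folded good_def]
  have good_t: "good ?t"
    using good_pow[of 1] by (simp add: K.int_pow_one_exp)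
  have good_base: "good (el f r 0)" if r: "r \<noteq> 0" for r
  proof -
    obtain n u where nu: "u \<in> units" "r = z powi n * u"
      using exponent_and_unit[OF r] .
    have "u * \<epsilon> powi (- n) \<in> units"
      by (intro units_mult units_power_int nu unit)
    then have "good (el f (u * \<epsilon> powi (- n)) 0 \<otimes>\<^bsub>K\<^esub> ?t [^]\<^bsub>K\<^esub> (2 * n))"
      by (intro good_mult good_pow good_unit base_unit)
    moreover have "el f (u * \<epsilon> powi (- n)) 0 \<otimes>\<^bsub>K\<^esub> ?t [^]\<^bsub>K\<^esub> (2 * n) = el f r 0"
      unfolding uniformizer_even_power nu(2) using units_nonzero[OF unit]
      by (simp add: el_mult el_eq_iff power_int_mult_distrib power_int_minus)
    ultimately show ?thesis by simp
  qed
  have factor: "good h" if h: "h \<in> carrier K" "h \<noteq> \<zero>\<^bsub>K\<^esub>" for h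
  proof -
    obtain r s' where rs': "h = el f r s'"
      using carrier_function_field_cases h(1) by blast
    define s where "s = s' / w"
    have rs: "h = el f r (s * w)"
      using w_nonzero by (simp add: s_def rs')
    show ?thesis
    proof (cases "r \<noteq> 0 \<and> s / r \<in> regular")
      case True
      then have "h = el f r 0 \<otimes>\<^bsub>K\<^esub> el f 1 (s / r * w)"
        by (simp add: rs el_mult)
      moreover have "good (el f r 0 \<otimes>\<^bsub>K\<^esub> el f 1 (s / r * w))"
        using good_mult[OF good_base good_unit[OF ramified_unit]] True by blast
      ultimately show ?thesis
        by simp
    next
      case False
      have s: "s \<noteq> 0"
        using False h(2) rs zero_regular by (auto simp: el_eq_zero_iff)
      \<comment> \<open>Here \<open>r/s\<close> is even a multiple of \<open>z = W\<^sup>2 / \<epsilon>\<close>, so \<open>W\<close> divides \<open>r + s W\<close>.\<close>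
      obtain p where p: "p \<in> regular" "r / s = z * p"
      proof (cases "r = 0")
        case True
        then show ?thesis
          using that[of 0] zero_regular by simp
      next
        case False
        then show ?thesis
          using regular_or_inverse[of "s / r"] that \<open>\<not> (r \<noteq> 0 \<and> s / r \<in> regular)\<close> s by auto
      qed
      define q where "q = p / \<epsilon>"
      have q: "q \<in> regular"
        unfolding q_def using regular_mult[OF p(1) units_regular[OF units_inverse[OF unit]]] by simp
      have "r = s * (z * (q * \<epsilon>))"
        using p(2) s units_nonzero[OF unit] by (simp add: q_def field_simps)
      moreover have "?t \<otimes>\<^bsub>K\<^esub> el f 1 (q * w) = el f (z * (q * \<epsilon>)) w"
        using el_mult_w[of 0 1 1 q] by simp
      ultimately have "h = el f s 0 \<otimes>\<^bsub>K\<^esub> (?t \<otimes>\<^bsub>K\<^esub> el f 1 (q * w))"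
        by (simp add: rs el_mult)
      then show ?thesis
        using good_mult[OF good_base[OF s] good_mult[OF good_t good_unit[OF ramified_unit[OF q]]]] by simp
    qed
  qed
  have "inv\<^bsub>K\<^esub> ?t \<notin> ramified_ring"
  proof -
    have "1 / (w * F) = (1 / \<epsilon> / z) * w"
      using w_square w_nonzero F_nonzero z_nonzero units_nonzero[OF unit] by (simp add: field_simps)
    then show ?thesis
      using ramified_ring_iff[of 0 "1 / \<epsilon> / z"] inverse_z_not_regular[OF units_inverse[OF unit]]
        el_inv_Y[OF w_nonzero] by simp
  qed
  then show ?thesis
    using ramified_ring_subring ramified_ringI[OF zero_regular one_regular] uniformizer_nonzero factor
    unfolding good_def by (intro discrete_valuation_subring.intro K.field_axioms discrete_valuation_subring_axioms.intro) auto
qed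

text \<open>
  A multiple of the uniformizer \<open>w Y\<close>. The coordinate \<open>Y\<close> at a zero of \<open>f\<close> and the coordinate \<open>1/Y\<close> at
  infinity have this form, so they lie in the maximal ideal.
\<close>

lemma odd_part_nonunit:
  assumes "s \<in> units" "s' = z ^ n * s * w"
  shows "el f 0 s' \<in> ramified_ring - Units (K\<lparr>carrier := ramified_ring\<rparr>)"
proof -
  let ?t = "el f 0 w"
  interpret V: discrete_valuation_subring K ramified_ring ?t
    by (rule ramified_valuation_ring)
  have "el f (z ^ n * s) 0 \<in> ramified_ring"
    using assms by (intro ramified_ring_base regular_mult regular_power z_regular units_regular)
  moreover have "el f 0 s' = el f (z ^ n * s) 0 \<otimes>\<^bsub>K\<^esub> ?t"
    by (simp add: assms el_mult)
  ultimately show ?thesis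
    unfolding V.generated_by_t[symmetric] cgenideal_def by auto
qed

lemma z_nonunit: "el f z 0 \<in> ramified_ring - Units (K\<lparr>carrier := ramified_ring\<rparr>)"
proof -
  have "inv\<^bsub>K\<^esub> el f z 0 \<notin> ramified_ring"
    using ramified_ring_iff[of "1 / z" 0] inverse_z_not_regular[OF one_units] z_nonzero
    by (simp add: el_inv_base)
  then show ?thesis
    using ramified_ring_base[OF z_regular] K.subring_Units_iff[OF ramified_ring_subring] by auto
qed

text \<open>
  Elements of \<open>ramified_ring\<close> have regular trace and norm over the rational function field, so they
  are integral over any ring containing the functions that are regular at the place.
\<close>

lemma ramified_ring_integral:
  assumes L: "subring L K" "\<And>r. r \<in> regular \<Longrightarrow> el f r 0 \<in> L"
  shows "ramified_ring \<subseteq> integral_closure_in K L"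
proof
  fix h assume "h \<in> ramified_ring"
  then obtain r s where rs: "r \<in> regular" "s \<in> regular" "h = el f r (s * w)"
    by (auto simp: ramified_ring_def)
  show "h \<in> integral_closure_in K L"
  proof (rule integral_closure_of_degree_2[OF cring_function_field subringE(1)[OF L(1)]])
    show "h \<in> carrier K"
      by (simp add: rs)
    have "r * r - s * s * \<epsilon> * z \<in> regular"
      using rs by (intro regular_diff regular_mult z_regular units_regular[OF unit])
    then show "el f (r * r - s * s * \<epsilon> * z) 0 \<in> L"
      by (rule L(2))
    show "el f (- (r + r)) 0 \<in> L"
      by (intro L(2) regular_uminus regular_add rs)
    show "h \<otimes>\<^bsub>K\<^esub> h \<oplus>\<^bsub>K\<^esub> (el f (- (r + r)) 0 \<otimes>\<^bsub>K\<^esub> h \<oplus>\<^bsub>K\<^esub> el f (r * r - s * s * \<epsilon> * z) 0) = \<zero>\<^bsub>K\<^esub>"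
      unfolding rs(3) el_mult_w by (simp add: el_mult el_add el_eq_zero_iff algebra_simps)
  qed
qed

end

section \<open>The points of the normalization\<close>

lemma to_fract_power: "to_fract (p ^ n) = to_fract p ^ n"
  by (induction n) simp_all

context odd_degree_curve
begin

lemma local_coord_simps:
  "local_coord f (ratfun_X f) (Some c) = el f (to_fract [:- c, 1:]) 0"
  "local_coord f (ratfun_X f) None = el f (1 / to_fract [:0, 1:]) 0"
  "local_coord f (ratfun_Y f) (Some d) = el f (- to_fract [:d:]) 1"
  "local_coord f (ratfun_Y f) None = el f 0 (1 / F)"
proof -
  have "[:- c, 1:] = [:0, 1:] - [:c:]" by simp
  then show "local_coord f (ratfun_X f) (Some c) = el f (to_fract [:- c, 1:]) 0"
    by (simp only: to_fract_diff) (simp add: ratfun_X_el ratfun_const_el el_minus)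
qed (simp_all add: ratfun_X_el ratfun_Y_el ratfun_const_el el_minus el_inv_base el_inv_Y)

lemma Y_in_subring:
  assumes "subring A K" "range (ratfun_const f) \<subseteq> A" "el f (- to_fract [:d:]) 1 \<in> A"
  shows "el f 0 1 \<in> A"
proof -
  have "ratfun_const f d \<oplus>\<^bsub>K\<^esub> el f (- to_fract [:d:]) 1 \<in> A"
    using subringE(7)[OF assms(1)] assms(2,3) by blast
  then show ?thesis
    by (simp add: ratfun_const_el el_add)
qed

lemma chart_coords_carrier: "chart_coords f p \<subseteq> carrier K"
  unfolding chart_coords_def
  by (cases "fst p"; cases "snd p") (simp_all add: local_coord_simps del: local_coord.simps)

lemma rational_point_chart:
  "rational_point K (range (ratfun_const f)) (chart_ring f p) (chart_ideal f p)"
  "chart_coords f p \<subseteq> chart_ideal f p"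
  unfolding chart_ring_def chart_ideal_def
  by (rule K.rational_point_generate_ring[OF subfield_constants chart_coords_carrier])+

text \<open>
  If the coordinates of the chart generated the unit ideal, the localization would have no
  denominators and would be empty, and so would its integral closure; but a ring with a maximal ideal
  has a zero element. This excludes the positions where the coordinates cannot vanish together.
\<close>

lemma proper_rational_point_chart:
  assumes "P \<in> normalized_curve f"
  shows "proper_rational_point K (range (ratfun_const f)) (chart_ring f (fst P)) (chart_ideal f (fst P))"
proof -
  interpret C: rational_point K "range (ratfun_const f)" "chart_ring f (fst P)" "chart_ideal f (fst P)"
    by (rule rational_point_chart)
  have "\<one>\<^bsub>K\<^esub> \<notin> chart_ideal f (fst P)"
  proof
    assume "\<one>\<^bsub>K\<^esub> \<in> chart_ideal f (fst P)"
    then have "normalized_local_ring f (fst P) = {}"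
      unfolding normalized_local_ring_def local_ring_def
      using C.localization_empty integral_closure_of_empty[OF K.field_axioms] by simp
    moreover have "maximalideal (snd P) (K\<lparr>carrier := normalized_local_ring f (fst P)\<rparr>)"
      using assms by (auto simp: normalized_curve_def)
    then have "\<zero>\<^bsub>K\<^esub> \<in> normalized_local_ring f (fst P)"
      using additive_subgroup.zero_closed[OF ideal.axioms(1)[OF maximalideal.axioms(1)]]
        ideal.Icarr[OF maximalideal.axioms(1)] by fastforce
    ultimately show False by simp
  qed
  then show ?thesis
    by (intro proper_rational_point.intro C.rational_point_axioms proper_rational_point_axioms.intro)
qed

end

context ramified_place
begin

text \<open>
  The local ring lies in the integrally closed ring \<open>ramified_ring\<close>, which is integral over it.
\<close>

lemma normalized_local_ring_ramified:
  assumes P: "proper_rational_point K constants (chart_ring f p) (chart_ideal f p)"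
    and z: "el f z 0 \<in> chart_ideal f p"
    and coords: "chart_coords f p \<subseteq> ramified_ring - Units (K\<lparr>carrier := ramified_ring\<rparr>)"
  shows "normalized_local_ring f p = ramified_ring"
proof
  interpret V: discrete_valuation_subring K ramified_ring "el f 0 w"
    by (rule ramified_valuation_ring)
  interpret P: proper_rational_point K constants "chart_ring f p" "chart_ideal f p"
    by (rule P)
  have "constants \<subseteq> ramified_ring"
    using ramified_ring_base[OF const_regular] by (auto simp: ratfun_const_el)
  then have "local_ring f p \<subseteq> ramified_ring"
    unfolding local_ring_def chart_ideal_def chart_ring_def
    by (rule V.localization_generate_ring_subset(1)[OF subfield_constants _ coords])
  then show "normalized_local_ring f p \<subseteq> ramified_ring"
    unfolding normalized_local_ring_def by (rule V.integrally_closed)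
  show "ramified_ring \<subseteq> normalized_local_ring f p"
    unfolding normalized_local_ring_def local_ring_def
    by (rule ramified_ring_integral[OF P.L_subring regular_in_local_ring[OF P z]])
qed

end

text \<open>
  If all zeros of \<open>f\<close> have odd order, then every point of the curve with \<open>Y = 0\<close>, however singular, is
  unibranch and is a branch point of the normalization over the \<open>X\<close>-line.
\<close>

locale odd_order_curve = odd_degree_curve +
  assumes odd_order: "poly f c = 0 \<Longrightarrow> odd (Polynomial.order c f)"
begin

text \<open>
  The chart ideal contains \<open>X - c\<close> and \<open>Y - d\<close>. If \<open>d \<noteq> 0\<close>, then \<open>Y\<close> is a unit of the local ring, which is the
  unramified case. If \<open>d = 0\<close>, then \<open>f(c) = 0\<close> since \<open>f(X) = Y\<^sup>2\<close> lies in the ideal, and \<open>f\<close> has odd order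
  at \<open>c\<close>, which is the ramified case.
\<close>

lemma finite_point:
  assumes P: "P \<in> normalized_curve f" and c: "structure_morphism P = Some c"
  obtains t where "discrete_valuation_subring K (normalized_local_ring f (fst P)) t"
    "range (ratfun_const f) \<subseteq> normalized_local_ring f (fst P)"
    "ratfun_X f \<in> normalized_local_ring f (fst P)" "ratfun_Y f \<in> normalized_local_ring f (fst P)"
proof -
  note point = that
  obtain d' where p: "fst P = (Some c, d')"
    using c by (cases "fst P") (auto simp: structure_morphism_def)
  define A where "A = chart_ring f (fst P)"
  define M where "M = chart_ideal f (fst P)"
  define z where "z = to_fract [:- c, 1:]"
  interpret Z: place z
    unfolding z_def by (rule place_finite)
  interpret curve_at_place f z ..
  have prp: "proper_rational_point K constants A M"
    unfolding A_def M_def by (rule proper_rational_point_chart[OF P])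
  interpret C: proper_rational_point K constants A M
    by (rule prp)
  have coords: "chart_coords f (fst P) = {el f z 0, local_coord f (ratfun_Y f) d'}"
    by (simp add: chart_coords_def p local_coord_simps z_def del: local_coord.simps)
  then have z: "el f z 0 \<in> M" and y: "local_coord f (ratfun_Y f) d' \<in> M"
    using rational_point_chart(2)[of "fst P"] by (auto simp: M_def)
  have poly_in_A: "el f (to_fract q) 0 \<in> A" for q
    using peval_in_subring[OF C.A_subring C.C_subset C.M_subset[OF z], of "q \<circ>\<^sub>p [:c, 1:]"]
      to_fract_eq_peval_finite[of q c] by (simp add: z_def)
  \<comment> \<open>\<open>Y\<close> has no pole where \<open>X\<close> is finite, since \<open>f(X) (1/Y)\<^sup>2 = 1\<close>.\<close>
  have "d' \<noteq> None"
  proof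
    assume "d' = None"
    then have Y': "el f 0 (1 / F) \<in> M"
      using y by (simp add: local_coord_simps del: local_coord.simps)
    then have "el f F 0 \<otimes>\<^bsub>K\<^esub> el f 0 (1 / F) \<in> M"
      by (rule C.M_mult[OF poly_in_A])
    then have "el f 0 (1 / F) \<otimes>\<^bsub>K\<^esub> (el f F 0 \<otimes>\<^bsub>K\<^esub> el f 0 (1 / F)) \<in> M"
      by (rule C.M_mult[OF C.M_subset[OF Y']])
    moreover have "el f 0 (1 / F) \<otimes>\<^bsub>K\<^esub> (el f F 0 \<otimes>\<^bsub>K\<^esub> el f 0 (1 / F)) = \<one>\<^bsub>K\<^esub>"
      using F_nonzero by (simp add: el_mult el_one)
    ultimately show False
      using C.one_notin by simp
  qed
  then obtain d where d: "d' = Some d" by auto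
  have yd: "el f (- to_fract [:d:]) 1 \<in> M"
    using y by (simp add: d local_coord_simps del: local_coord.simps)
  have Y_in_A: "el f 0 1 \<in> A"
    by (rule Y_in_subring[OF C.A_subring C.C_subset C.M_subset[OF yd]])
  have *: thesis if t: "discrete_valuation_subring K (normalized_local_ring f (fst P)) t"
    and L: "C.L \<subseteq> normalized_local_ring f (fst P)" for t
  proof (rule point[OF t])
    show "constants \<subseteq> normalized_local_ring f (fst P)"
      using C.A_subset_L C.C_subset L by blast
    show "ratfun_X f \<in> normalized_local_ring f (fst P)" "ratfun_Y f \<in> normalized_local_ring f (fst P)"
      using C.A_subset_L L poly_in_A Y_in_A by (auto simp: ratfun_X_el ratfun_Y_el)
  qed
  have L: "local_ring f (fst P) = C.L"
    by (simp add: local_ring_def A_def M_def)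
  have L_sub: "C.L \<subseteq> normalized_local_ring f (fst P)"
    unfolding normalized_local_ring_def L
    using integral_closure_of_degree_1[OF cring_function_field C.L_subring] by blast
  show thesis
  proof (cases "d = 0")
    case False
    have "ratfun_const f d \<notin> M"
      using C.C_M_zero[of "ratfun_const f d"] False by (auto simp: ratfun_const_el el_eq_zero_iff)
    moreover have "ratfun_const f d = el f 0 1 \<ominus>\<^bsub>K\<^esub> el f (- to_fract [:d:]) 1"
      by (simp add: ratfun_const_el el_minus)
    ultimately have "el f 0 1 \<in> A - M"
      using C.M_diff[OF _ yd, of "el f 0 1"] Y_in_A by auto
    then have dvr: "discrete_valuation_subring K C.L (el f z 0)"
      by (rule unramified_valuation_ring[OF prp z])
    then have "normalized_local_ring f (fst P) = C.L"
      using discrete_valuation_subring.integrally_closed[OF dvr order_refl] L_sub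
      unfolding normalized_local_ring_def L by blast
    then show ?thesis
      using * dvr L_sub by simp
  next
    case True
    then have Y: "el f 0 1 \<in> M"
      using yd by simp
    have "poly f c = 0"
    proof (rule ccontr)
      assume "poly f c \<noteq> 0"
      then have "poly (f \<circ>\<^sub>p [:c, 1:]) 0 \<noteq> 0"
        by (simp add: poly_pcompose)
      then have "el f F 0 \<notin> M"
        using peval_notin_ideal[OF prp z] to_fract_eq_peval_finite[of f c] by (simp add: z_def)
      moreover have "el f F 0 = el f 0 1 \<otimes>\<^bsub>K\<^esub> el f 0 1"
        by (simp add: el_mult)
      ultimately show False
        using C.M_mult[OF Y_in_A Y] by simp
    qed
    then have "odd (Polynomial.order c f)"
      by (rule odd_order)
    then obtain n where n: "Polynomial.order c f = 2 * n + 1"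
      by (rule oddE)
    have "f \<noteq> 0"
      using odd_degree by auto
    then obtain q where q: "f = [:- c, 1:] ^ (2 * n + 1) * q" "\<not> [:- c, 1:] dvd q"
      using order_decomp[of f c] n by auto
    have "poly (q \<circ>\<^sub>p [:c, 1:]) 0 \<noteq> 0"
      using q(2) by (simp add: poly_pcompose poly_eq_0_iff_dvd)
    then have q_unit: "to_fract q \<in> Z.units"
      using Z.peval_units to_fract_eq_peval_finite[of q c] by (simp add: z_def)
    have "F = to_fract q * z powi (2 * int n + 1)"
    proof -
      have "F = z ^ (2 * n + 1) * to_fract q"
        by (subst q(1)) (simp only: to_fract_mult to_fract_power z_def)
      also have "\<dots> = to_fract q * z powi int (2 * n + 1)"
        by (simp only: power_int_of_nat mult.commute)
      finally show ?thesis
        by (simp only: of_nat_add of_nat_mult of_nat_numeral of_nat_1)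
    qed
    then interpret ramified_place f z "to_fract q" "int n"
      using q_unit by unfold_locales
    have "el f 0 1 \<in> ramified_ring - Units (K\<lparr>carrier := ramified_ring\<rparr>)"
      using odd_part_nonunit[OF Z.one_units, of 1 n] Z.z_nonzero by (simp add: w_def power_int_minus)
    then have "chart_coords f (fst P) \<subseteq> ramified_ring - Units (K\<lparr>carrier := ramified_ring\<rparr>)"
      unfolding coords using z_nonunit True by (simp add: d local_coord_simps del: local_coord.simps)
    then have "normalized_local_ring f (fst P) = ramified_ring"
      using prp z by (intro normalized_local_ring_ramified) (simp_all add: A_def M_def)
    then show ?thesis
      using * L_sub ramified_valuation_ring by simp
  qed
qed

text \<open>
  In terms of \<open>z = 1/X\<close>, the reversed polynomial of \<open>f\<close> shows that \<open>f\<close> has order \<open>- degree f\<close>, which is odd. So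
  infinity is a branch point, \<open>1/X\<close> vanishes to order \<open>2\<close> there, and \<open>Y\<close> has a pole of order \<open>degree f\<close>.
\<close>

lemma infinite_point:
  assumes P: "P \<in> normalized_curve f" and inf: "structure_morphism P = None"
  defines "V \<equiv> normalized_local_ring f (fst P)"
  shows "subring V K" "range (ratfun_const f) \<subseteq> V"
    "\<And>m. el f ((1 / to_fract [:0, 1:]) ^ m) 0 \<in> V"
    "\<And>m. Polynomial.degree f < 2 * m \<Longrightarrow> el f 0 ((1 / to_fract [:0, 1:]) ^ m) \<in> V"
    "\<And>h k. \<lbrakk>h \<in> carrier K; h \<noteq> \<zero>\<^bsub>K\<^esub>; h \<otimes>\<^bsub>K\<^esub> el f ((1 / to_fract [:0, 1:]) ^ k) 0 \<in> V\<rbrakk>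
      \<Longrightarrow> - 2 * int k \<le> vanishing_order f P h"
proof -
  obtain d' where p: "fst P = (None, d')"
    using inf by (cases "fst P") (auto simp: structure_morphism_def)
  define A where "A = chart_ring f (fst P)"
  define M where "M = chart_ideal f (fst P)"
  define z where "z = 1 / to_fract [:0, 1::complex:]"
  interpret Z: place z
    unfolding z_def by (rule place_infinity)
  interpret curve_at_place f z ..
  have prp: "proper_rational_point K constants A M"
    unfolding A_def M_def by (rule proper_rational_point_chart[OF P])
  interpret C: proper_rational_point K constants A M
    by (rule prp)
  have coords: "chart_coords f (fst P) = {el f z 0, local_coord f (ratfun_Y f) d'}"
    by (simp add: chart_coords_def p local_coord_simps z_def del: local_coord.simps)
  then have z: "el f z 0 \<in> M" and y: "local_coord f (ratfun_Y f) d' \<in> M"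
    using rational_point_chart(2)[of "fst P"] by (auto simp: M_def)
  define \<epsilon> where "\<epsilon> = peval z (reflect_poly f)"
  have f: "f \<noteq> 0"
    using odd_degree by auto
  then have lead: "poly (reflect_poly f) 0 \<noteq> 0"
    by simp
  obtain n where n: "Polynomial.degree f = 2 * n + 1"
    using odd_degree by (auto elim: oddE)
  have F: "z ^ Polynomial.degree f * F = \<epsilon>"
    unfolding \<epsilon>_def z_def by (subst (2) to_fract_eq_peval_infinity) (simp add: power_one_over)
  have "F = \<epsilon> * z powi (- int (Polynomial.degree f))"
    using F Z.z_nonzero by (simp add: power_int_minus field_simps)
  then have "F = \<epsilon> * z powi (2 * (- int n - 1) + 1)"
    by (simp add: n algebra_simps)
  then interpret ramified_place f z \<epsilon> "- int n - 1"
    using Z.peval_units[OF lead] by unfold_locales (simp_all add: \<epsilon>_def)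
  have w: "w = z ^ (n + 1)"
    by (simp add: w_def power_int_def nat_add_distrib)
  \<comment> \<open>\<open>Y\<close> has a pole: otherwise \<open>z\<^sup>2\<^sup>n\<^sup>+\<^sup>1 Y\<^sup>2 = \<epsilon>\<close> would vanish at \<open>z = 0\<close>.\<close>
  have "d' = None"
  proof (rule ccontr)
    assume "d' \<noteq> None"
    then obtain d where d: "d' = Some d" by auto
    have yd: "el f (- to_fract [:d:]) 1 \<in> M"
      using y by (simp add: d local_coord_simps del: local_coord.simps)
    have Y_in_A: "el f 0 1 \<in> A"
      by (rule Y_in_subring[OF C.A_subring C.C_subset C.M_subset[OF yd]])
    have "el f (z ^ (2 * n)) 0 \<in> A"
      using peval_in_subring[OF C.A_subring C.C_subset C.M_subset[OF z], of "[:0, 1:] ^ (2 * n)"]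
      by (simp flip: one_pCons)
    then have "el f (z ^ (2 * n)) 0 \<otimes>\<^bsub>K\<^esub> (el f 0 1 \<otimes>\<^bsub>K\<^esub> (el f 0 1 \<otimes>\<^bsub>K\<^esub> el f z 0)) \<in> M"
      using Y_in_A z by (intro C.M_mult)
    moreover have "el f (z ^ (2 * n)) 0 \<otimes>\<^bsub>K\<^esub> (el f 0 1 \<otimes>\<^bsub>K\<^esub> (el f 0 1 \<otimes>\<^bsub>K\<^esub> el f z 0)) = el f \<epsilon> 0"
      using F by (simp add: el_mult n mult_ac)
    ultimately show False
      using peval_notin_ideal[OF prp z lead] by (simp add: \<epsilon>_def)
  qed
  have "el f 0 (1 / F) \<in> ramified_ring - Units (K\<lparr>carrier := ramified_ring\<rparr>)"
  proof (rule odd_part_nonunit[OF Z.units_inverse[OF unit]])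
    have "z ^ n * (1 / \<epsilon>) * w = z ^ (2 * n + 1) / \<epsilon>"
      by (simp add: w mult_2 power_add)
    also have "\<dots> = 1 / F"
      using F F_nonzero Z.units_nonzero[OF unit] n by (simp add: field_simps)
    finally show "1 / F = z ^ n * (1 / \<epsilon>) * w" ..
  qed
  then have "chart_coords f (fst P) \<subseteq> ramified_ring - Units (K\<lparr>carrier := ramified_ring\<rparr>)"
    unfolding coords using z_nonunit \<open>d' = None\<close> by (simp add: local_coord_simps del: local_coord.simps)
  then have V: "V = ramified_ring"
    unfolding V_def using prp z by (intro normalized_local_ring_ramified) (simp_all add: A_def M_def)
  show "subring V K"
    unfolding V by (rule ramified_ring_subring)
  show "range (ratfun_const f) \<subseteq> V"
    unfolding V using ramified_ring_base[OF Z.const_regular] by (auto simp: ratfun_const_el)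
  show "el f ((1 / to_fract [:0, 1:]) ^ m) 0 \<in> V" for m
    unfolding V z_def[symmetric] by (intro ramified_ring_base Z.regular_power Z.z_regular)
  show "el f 0 ((1 / to_fract [:0, 1:]) ^ m) \<in> V" if "Polynomial.degree f < 2 * m" for m
  proof -
    have "z ^ m = z ^ (m - (n + 1)) * w"
      unfolding w using that n power_add[of z "m - (n + 1)" "n + 1"] by simp
    moreover have "el f 0 (z ^ (m - (n + 1)) * w) \<in> ramified_ring"
      by (intro ramified_ringI Z.zero_regular Z.regular_power Z.z_regular)
    ultimately show ?thesis
      unfolding V z_def[symmetric] by simp
  qed
  show "- 2 * int k \<le> vanishing_order f P h"
    if h: "h \<in> carrier K" "h \<noteq> \<zero>\<^bsub>K\<^esub>" "h \<otimes>\<^bsub>K\<^esub> el f ((1 / to_fract [:0, 1:]) ^ k) 0 \<in> V" for h k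
  proof -
    let ?g = "h \<otimes>\<^bsub>K\<^esub> el f (z ^ k) 0"
    define v where "v = ?g \<otimes>\<^bsub>K\<^esub> el f (\<epsilon> ^ k) 0"
    have \<epsilon>: "\<epsilon> \<noteq> 0"
      using Z.units_nonzero[OF unit] .
    have "?g \<in> ramified_ring"
      using h(3) unfolding V z_def .
    moreover have "el f (\<epsilon> ^ k) 0 \<in> ramified_ring"
      by (intro ramified_ring_base Z.regular_power Z.units_regular unit)
    ultimately have "v \<in> V"
      unfolding v_def V using subringE(6)[OF ramified_ring_subring] by blast
    moreover have "v \<noteq> \<zero>\<^bsub>K\<^esub>"
      unfolding v_def using h(1,2) \<epsilon> Z.z_nonzero by (simp add: K.integral_iff el_eq_zero_iff)
    moreover have "h = v \<otimes>\<^bsub>K\<^esub> el f 0 w [^]\<^bsub>K\<^esub> (2 * (- int k))"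
    proof -
      have "v \<otimes>\<^bsub>K\<^esub> el f 0 w [^]\<^bsub>K\<^esub> (2 * (- int k))
          = h \<otimes>\<^bsub>K\<^esub> (el f (z ^ k) 0 \<otimes>\<^bsub>K\<^esub> (el f (\<epsilon> ^ k) 0 \<otimes>\<^bsub>K\<^esub> el f ((\<epsilon> * z) powi (- int k)) 0))"
        unfolding v_def uniformizer_even_power using h(1) by (simp add: K.m_assoc)
      also have "el f (z ^ k) 0 \<otimes>\<^bsub>K\<^esub> (el f (\<epsilon> ^ k) 0 \<otimes>\<^bsub>K\<^esub> el f ((\<epsilon> * z) powi (- int k)) 0) = \<one>\<^bsub>K\<^esub>"
        using \<epsilon> Z.z_nonzero by (simp add: el_mult el_one el_eq_iff power_int_minus power_mult_distrib field_simps)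
      finally show ?thesis
        using h(1) by simp
    qed
    ultimately have "2 * (- int k) \<le> vanishing_order f P h"
      using vanishing_order_ge[OF P, of "el f 0 w" v h "2 * (- int k)"] ramified_valuation_ring V
      unfolding V_def by simp
    then show ?thesis by simp
  qed
qed

end

section \<open>Real functions\<close>

lemma (in ring) Span_subset:
  assumes "set Us \<subseteq> W" "\<zero> \<in> W" "\<And>x y. x \<in> W \<Longrightarrow> y \<in> W \<Longrightarrow> x \<oplus> y \<in> W"
    and "\<And>c x. c \<in> C \<Longrightarrow> x \<in> W \<Longrightarrow> c \<otimes> x \<in> W"
  shows "Span C Us \<subseteq> W"
  using assms(1)
proof (induction Us)
  case Nil
  then show ?case
    using assms(2) by simp
next
  case (Cons u Us)
  show ?case
  proof
    fix x assume "x \<in> Span C (u # Us)"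
    then obtain c v where "c \<in> C" "v \<in> Span C Us" "x = c \<otimes> u \<oplus> v"
      by (auto simp: line_extension_def set_add_def' r_coset_def)
    then show "x \<in> W"
      using Cons assms(3,4) by auto
  qed
qed

lemma map_poly_cnj_add: "map_poly cnj (p + q) = map_poly cnj p + map_poly cnj q"
  by (rule poly_eqI) (simp add: coeff_map_poly)

lemma map_poly_cnj_involution: "map_poly cnj (map_poly cnj p) = p"
  by (rule poly_eqI) (simp add: coeff_map_poly)

lemma fract_cnj_to_fract: "fract_cnj (to_fract p) = to_fract (map_poly cnj p)"
  using fract_cnj_divide[of 1 p] by simp

lemma fract_cnj_mult: "fract_cnj (r * s) = fract_cnj r * fract_cnj s"
proof -
  obtain p q where r: "q \<noteq> 0" "r = to_fract p / to_fract q"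
    by (rule fract_as_quotient)
  obtain p' q' where s: "q' \<noteq> 0" "s = to_fract p' / to_fract q'"
    by (rule fract_as_quotient)
  have "r * s = to_fract (p * p') / to_fract (q * q')"
    by (simp add: r s)
  then have "fract_cnj (r * s) = to_fract (map_poly cnj (p * p')) / to_fract (map_poly cnj (q * q'))"
    using r(1) s(1) by (simp only: fract_cnj_divide mult_eq_0_iff simp_thms)
  then show ?thesis
    using r(1) s(1) by (simp add: r(2) s(2) fract_cnj_divide map_poly_cnj_mult)
qed

lemma fract_cnj_add: "fract_cnj (r + s) = fract_cnj r + fract_cnj s"
proof -
  obtain p q where r: "q \<noteq> 0" "r = to_fract p / to_fract q"
    by (rule fract_as_quotient)
  obtain p' q' where s: "q' \<noteq> 0" "s = to_fract p' / to_fract q'"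
    by (rule fract_as_quotient)
  have "r + s = to_fract (p * q' + p' * q) / to_fract (q * q')"
    using r s by (simp add: add_frac_eq)
  then have "fract_cnj (r + s) = to_fract (map_poly cnj (p * q' + p' * q)) / to_fract (map_poly cnj (q * q'))"
    using r(1) s(1) by (simp only: fract_cnj_divide mult_eq_0_iff simp_thms)
  then show ?thesis
    using r(1) s(1)
    by (simp add: r(2) s(2) fract_cnj_divide map_poly_cnj_add map_poly_cnj_mult map_poly_cnj_eq_0_iff add_frac_eq)
qed

lemma fract_cnj_0 [simp]: "fract_cnj 0 = 0" and fract_cnj_1 [simp]: "fract_cnj 1 = 1"
  using fract_cnj_to_fract[of 0] fract_cnj_to_fract[of 1] by simp_all

lemma fract_cnj_power: "fract_cnj (r ^ n) = fract_cnj r ^ n"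
  by (induction n) (simp_all add: fract_cnj_mult)

lemma fract_cnj_sum: "fract_cnj (sum g A) = (\<Sum>x\<in>A. fract_cnj (g x))"
  by (induction A rule: infinite_finite_induct) (simp_all add: fract_cnj_add)

lemma fract_cnj_involution: "fract_cnj (fract_cnj r) = r"
proof -
  obtain p q where r: "q \<noteq> 0" "r = to_fract p / to_fract q"
    by (rule fract_as_quotient)
  then show ?thesis
    by (simp add: fract_cnj_divide map_poly_cnj_eq_0_iff map_poly_cnj_involution)
qed

lemma map_poly_fract_cnj_add: "map_poly fract_cnj (p + q) = map_poly fract_cnj p + map_poly fract_cnj q"
  by (rule poly_eqI) (simp add: coeff_map_poly fract_cnj_add)

lemma map_poly_fract_cnj_mult: "map_poly fract_cnj (p * q) = map_poly fract_cnj p * map_poly fract_cnj q"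
  by (rule poly_eqI) (simp add: coeff_map_poly coeff_mult fract_cnj_sum fract_cnj_mult)

lemma map_poly_fract_cnj_involution: "map_poly fract_cnj (map_poly fract_cnj p) = p"
  by (rule poly_eqI) (simp add: coeff_map_poly fract_cnj_involution)

text \<open>
  For real \<open>f\<close> the ideal of the curve is stable under conjugation of coefficients, so conjugation
  acts on cosets through representatives.
\<close>

lemma ratfun_cnj_residue_class:
  assumes "map_poly cnj f = f"
  shows "ratfun_cnj (residue_class f q) = residue_class f (map_poly fract_cnj q)"
proof -
  let ?c = "map_poly fract_cnj"
  have coset: "residue_class f q = (\<lambda>x. x + q) ` curve_ideal f" for q
    unfolding residue_class_def a_r_coset_def' by (auto simp: bivariate_ring_simps)
  have "fract_cnj (- to_fract f) = - to_fract f"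
    using fract_cnj_to_fract[of "- f"] assms fract_cnj_add[of "to_fract f" "- to_fract f"]
    by (simp add: fract_cnj_to_fract add_eq_0_iff)
  then have eq: "?c [:- to_fract f, 0, 1:] = [:- to_fract f, 0, 1:]"
    by (simp add: map_poly_pCons)
  have stable: "?c x \<in> curve_ideal f" if x: "x \<in> curve_ideal f" for x
  proof -
    obtain y where "x = [:- to_fract f, 0, 1:] * y"
      using x by (auto simp: curve_ideal_iff)
    then show ?thesis
      using eq by (auto simp: curve_ideal_iff map_poly_fract_cnj_mult simp del: mult_pCons_left)
  qed
  have "?c ` curve_ideal f = curve_ideal f"
    using stable map_poly_fract_cnj_involution by (metis image_subsetI image_eqI subsetI subset_antisym)
  then have "(\<lambda>x. x + ?c q) ` ?c ` curve_ideal f = residue_class f (?c q)"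
    by (simp add: coset)
  then show ?thesis
    unfolding ratfun_cnj_def coset[of q] by (simp add: image_image map_poly_fract_cnj_add)
qed

lemma el_real_iff:
  assumes "map_poly cnj f = f"
  shows "el f r s \<in> real_ratfuns f \<longleftrightarrow> fract_cnj r = r \<and> fract_cnj s = s"
proof -
  have "ratfun_cnj (el f r s) = el f (fract_cnj r) (fract_cnj s)"
    unfolding el_def ratfun_cnj_residue_class[OF assms] by (simp add: map_poly_pCons)
  then show ?thesis
    by (simp add: real_ratfuns_def el_eq_iff)
qed

lemma real_ratfuns_cases:
  assumes "map_poly cnj f = f" "h \<in> real_ratfuns f"
  obtains r s where "h = el f r s" "fract_cnj r = r" "fract_cnj s = s"
proof -
  have "h \<in> carrier (function_field f)"
    using assms(2) by (simp add: real_ratfuns_def)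
  then obtain r s where "h = el f r s"
    by (rule carrier_function_field_cases)
  then show ?thesis
    using that assms(2) el_real_iff[OF assms(1)] by simp
qed

lemma fract_cnj_real_const: "x \<in> \<real> \<Longrightarrow> fract_cnj (to_fract [:x:]) = to_fract [:x:]"
  by (simp add: fract_cnj_to_fract map_poly_pCons Reals_cnj_iff)

context odd_degree_curve
begin

lemma real_ratfuns_closed:
  assumes "map_poly cnj f = f"
  shows "\<zero>\<^bsub>K\<^esub> \<in> real_ratfuns f"
    and "g \<in> real_ratfuns f \<Longrightarrow> h \<in> real_ratfuns f \<Longrightarrow> g \<oplus>\<^bsub>K\<^esub> h \<in> real_ratfuns f"
    and "x \<in> \<real> \<Longrightarrow> h \<in> real_ratfuns f \<Longrightarrow> ratfun_const f x \<otimes>\<^bsub>K\<^esub> h \<in> real_ratfuns f"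
proof -
  show "\<zero>\<^bsub>K\<^esub> \<in> real_ratfuns f"
    by (simp add: el_zero el_real_iff[OF assms])
  show "g \<oplus>\<^bsub>K\<^esub> h \<in> real_ratfuns f" if "g \<in> real_ratfuns f" "h \<in> real_ratfuns f"
  proof -
    obtain r s r' s' where "g = el f r s" "fract_cnj r = r" "fract_cnj s = s"
        "h = el f r' s'" "fract_cnj r' = r'" "fract_cnj s' = s'"
      using real_ratfuns_cases[OF assms \<open>g \<in> real_ratfuns f\<close>] real_ratfuns_cases[OF assms \<open>h \<in> real_ratfuns f\<close>]
      by metis
    then show ?thesis
      by (simp add: el_add el_real_iff[OF assms] fract_cnj_add)
  qed
  show "ratfun_const f x \<otimes>\<^bsub>K\<^esub> h \<in> real_ratfuns f" if "x \<in> \<real>" "h \<in> real_ratfuns f"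
  proof -
    obtain r s where "h = el f r s" "fract_cnj r = r" "fract_cnj s = s"
      using real_ratfuns_cases[OF assms \<open>h \<in> real_ratfuns f\<close>] .
    then show ?thesis
      using that(1)
      by (simp add: ratfun_const_el el_mult el_real_iff[OF assms] fract_cnj_mult fract_cnj_real_const)
  qed
qed

end

section \<open>Pole orders of the generating functions\<close>

context odd_order_curve
begin

lemma X_power_el: "ratfun_X f [^]\<^bsub>K\<^esub> (j::nat) = el f (to_fract [:0, 1:] ^ j) 0"
  by (simp add: ratfun_X_el el_nat_pow)

lemma X_power_Y_el: "ratfun_X f [^]\<^bsub>K\<^esub> (j::nat) \<otimes>\<^bsub>K\<^esub> ratfun_Y f = el f 0 (to_fract [:0, 1:] ^ j)"
  by (simp add: X_power_el ratfun_Y_el el_mult)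

lemma fract_cnj_X_power: "fract_cnj (to_fract [:0, 1:] ^ j) = to_fract [:0, 1:] ^ j"
  by (simp add: fract_cnj_power fract_cnj_to_fract map_poly_pCons)

text \<open>
  Both conditions on a section are stable under real linear combinations, so it suffices to test the
  generators. At infinity, multiplication by \<open>X\<^sup>-\<^sup>k\<close>, which has order \<open>2 k\<close>, must make \<open>X\<^sup>j\<close> and \<open>X\<^sup>j Y\<close>
  regular; the latter holds when \<open>2 (k - j)\<close> exceeds the pole order \<open>degree f\<close> of \<open>Y\<close>.
\<close>

theorem real_span_in_real_sections:
  assumes real: "map_poly cnj f = f"
    and m: "\<And>j. j < m \<Longrightarrow> Polynomial.degree f + 2 * j < 2 * k"
  shows "real_span f
      (map (\<lambda>j. ratfun_X f [^]\<^bsub>K\<^esub> j) [0..<Suc k] @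
       map (\<lambda>j. ratfun_X f [^]\<^bsub>K\<^esub> j \<otimes>\<^bsub>K\<^esub> ratfun_Y f) [0..<m])
    \<subseteq> real_sections f (\<lambda>P. 2 * int k * infinity_divisor f P)" (is "real_span f ?Us \<subseteq> _")
proof -
  let ?x = "to_fract [:0, 1::complex:]"
  have gens: "u \<in> W" if "u \<in> set ?Us"
    and "\<And>j. j \<le> k \<Longrightarrow> el f (?x ^ j) 0 \<in> W" and "\<And>j. j < m \<Longrightarrow> el f 0 (?x ^ j) \<in> W" for u W
    using that by (auto simp: X_power_Y_el) (simp_all add: X_power_el)
  have span: "real_span f ?Us \<subseteq> W"
    if "\<And>j. j \<le> k \<Longrightarrow> el f (?x ^ j) 0 \<in> W" "\<And>j. j < m \<Longrightarrow> el f 0 (?x ^ j) \<in> W"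
      and "\<zero>\<^bsub>K\<^esub> \<in> W" "\<And>g h. g \<in> W \<Longrightarrow> h \<in> W \<Longrightarrow> g \<oplus>\<^bsub>K\<^esub> h \<in> W"
      and "\<And>c h. h \<in> W \<Longrightarrow> c \<in> \<real> \<Longrightarrow> ratfun_const f c \<otimes>\<^bsub>K\<^esub> h \<in> W" for W
    unfolding real_span_def using that gens[of _ W] by (intro K.Span_subset) auto
  show ?thesis
  proof
    fix h assume h: "h \<in> real_span f ?Us"
    have "real_span f ?Us \<subseteq> real_ratfuns f"
      by (rule span) (simp_all add: real_ratfuns_closed[OF real] el_real_iff[OF real] fract_cnj_X_power)
    then have h_real: "h \<in> real_ratfuns f"
      using h by blast
    then have h_carrier: "h \<in> carrier K"
      by (simp add: real_ratfuns_def)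
    have "0 \<le> vanishing_order f P h + 2 * int k * infinity_divisor f P"
      if nz: "h \<noteq> \<zero>\<^bsub>K\<^esub>" and P: "P \<in> normalized_curve f" for P
    proof (cases "structure_morphism P")
      case None
      let ?V = "normalized_local_ring f (fst P)"
      note V = infinite_point[OF P None]
      have inv: "?x ^ j * (1 / ?x) ^ k = (1 / ?x) ^ (k - j)" if "j \<le> k" for j
        using that by (simp add: power_one_over power_diff)
      define W where "W = {g \<in> carrier K. g \<otimes>\<^bsub>K\<^esub> el f ((1 / ?x) ^ k) 0 \<in> ?V}"
      have "real_span f ?Us \<subseteq> W"
      proof (rule span)
        fix j assume "j \<le> k"
        then show "el f (?x ^ j) 0 \<in> W"
          using V(3)[of "k - j"] by (simp add: W_def el_mult inv)
      next
        fix j assume "j < m"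
        then have "j \<le> k" "Polynomial.degree f < 2 * (k - j)"
          using m[of j] by auto
        then show "el f 0 (?x ^ j) \<in> W"
          using V(4)[of "k - j"] by (simp add: W_def el_mult inv)
      next
        show "\<zero>\<^bsub>K\<^esub> \<in> W"
          using subringE(2)[OF V(1)] by (simp add: W_def)
      next
        fix g h assume "g \<in> W" "h \<in> W"
        then show "g \<oplus>\<^bsub>K\<^esub> h \<in> W"
          using subringE(7)[OF V(1)] by (simp add: W_def K.l_distr)
      next
        fix c :: complex and h assume "h \<in> W"
        moreover have "ratfun_const f c \<in> ?V" "ratfun_const f c \<in> carrier K"
          using V(2) by (auto simp: ratfun_const_el)
        ultimately show "ratfun_const f c \<otimes>\<^bsub>K\<^esub> h \<in> W"
          using subringE(6)[OF V(1)] by (simp add: W_def K.m_assoc)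
      qed
      then have "- 2 * int k \<le> vanishing_order f P h"
        using h V(5)[OF h_carrier nz, of k] by (auto simp: W_def)
      then show ?thesis
        using P None by (simp add: infinity_divisor_def)
    next
      case (Some c)
      obtain t where V: "discrete_valuation_subring K (normalized_local_ring f (fst P)) t"
          "range (ratfun_const f) \<subseteq> normalized_local_ring f (fst P)"
          "ratfun_X f \<in> normalized_local_ring f (fst P)" "ratfun_Y f \<in> normalized_local_ring f (fst P)"
        using finite_point[OF P Some] .
      interpret V: discrete_valuation_subring K "normalized_local_ring f (fst P)" t
        by (rule V(1))
      have "real_span f ?Us \<subseteq> normalized_local_ring f (fst P)"
      proof (rule span)
        show "el f (?x ^ j) 0 \<in> normalized_local_ring f (fst P)" for j
          using V.V_nat_pow[OF V(3)] by (simp flip: X_power_el)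
        then show "el f 0 (?x ^ j) \<in> normalized_local_ring f (fst P)" for j
          using V(4) subringE(6)[OF V.subring] by (simp flip: X_power_Y_el add: X_power_el)
      qed (use V(2) subringE(2,6,7)[OF V.subring] in auto)
      then have "0 \<le> vanishing_order f P h"
        using h nz h_carrier by (intro vanishing_order_ge[OF P V(1)]) auto
      then show ?thesis
        using Some by (simp add: infinity_divisor_def)
    qed
    then show "h \<in> real_sections f (\<lambda>P. 2 * int k * infinity_divisor f P)"
      using h_real by (auto simp: real_sections_def effective_def principal_divisor_def)
  qed
qed

end

theorem lemma5p2:
  fixes k g i :: nat
    and a :: "nat \<Rightarrow> real"
    and x1 x2 :: complex
    and f :: "complex poly"
  assumes "k > g" and "g \<ge> 2" and "1 \<le> i" and "i \<le> g"
    and "f = (\<Sum>j = 2 * i - 1..2 * i + 1. Polynomial.monom (complex_of_real (a j)) j)"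
    and "f = Polynomial.smult (complex_of_real (a (2 * i + 1)))
               (Polynomial.monom 1 (2 * i - 1) * [:- x1, 1:] * [:- x2, 1:])"
    and "a (2 * i + 1) \<noteq> 0"
    and "x1 \<noteq> 0" and "x2 \<noteq> 0" and "x1 \<noteq> x2"
  shows "H_space f k g \<subseteq> real_sections f (\<lambda>P. 2 * int k * infinity_divisor f P)"
proof -
  have degree: "Polynomial.degree f = 2 * i + 1"
    using assms(3,7) unfolding assms(6)
    by (simp add: degree_mult_eq Polynomial.degree_monom_eq monom_eq_0_iff
        del: mult_pCons_left mult_pCons_right)
  have order: "Polynomial.order c f = (if c = 0 then 2 * i - 1 else 0) + (if c = x1 then 1 else 0) + (if c = x2 then 1 else 0)"
    for c
  proof -
    have "Polynomial.order c ([:0, 1:] ^ n) = (if c = 0 then n else 0)" for n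
      using order_power_n_n[of 0 n] by (auto intro: order_0I)
    moreover have "Polynomial.order c [:- x, 1:] = (if c = x then 1 else 0)" for x
      using order_power_n_n[of x 1] by (auto intro: order_0I)
    ultimately show ?thesis
      unfolding assms(6) using assms(7)
      by (simp add: order_smult order_mult monom_altdef del: mult_pCons_left mult_pCons_right)
  qed
  interpret odd_order_curve f
  proof
    show "odd (Polynomial.degree f)"
      by (simp add: degree)
    show "odd (Polynomial.order c f)" if "poly f c = 0" for c
    proof -
      have "Polynomial.order c f \<noteq> 0"
        using that degree by (auto simp: order_root)
      then show ?thesis
        using assms(3,8-10) unfolding order by (auto split: if_splits)
    qed
  qed
  have "map_poly cnj f = f"
    unfolding assms(5) by (rule poly_eqI) (simp add: coeff_map_poly coeff_sum)
  then show ?thesis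
    unfolding H_space_def
    using assms(1,4) by (intro real_span_in_real_sections) (auto simp: degree)
qed

end
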